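(* Let $g$ be an axially symmetric Kerr-like metric and $S=\{t=t_0,\ r=r_0\}$, with associated energy functional $E(x,y)$. Define, for $\theta\in[0,\pi]$ and $r=r_0$ (by continuous extension at $\theta=0,\pi$), \[K=-\frac{(\sqrt H\Sigma)_r}{2R}+\frac{\Sigma\sqrt{1-\frac{H_\theta^2}{4H\Sigma^2}}}{2}\sin^2\theta+\frac{H_\theta}{4\sqrt H}\cos\theta\sin\theta+\frac{\sqrt H}{2}.\] If the mean curvature of $S$ along the radial outer normal is positive, and there is some point $\theta_0\in[0,\pi]$ such that $K(\theta_0)>0$, then $(x,y)=(0,0)$ is a saddle critical point of $E(x,y)$.
   Context: A Kerr-like axially symmetric metric is a smooth Lorentzian metric \[g=F\,dt^2+2G\,dt\,d\phi+H\,d\phi^2+R^2dr^2+\Sigma^2d\theta^2,\] where $F,G,H,R,\Sigma$ are functions of $(r,\theta)$ only, $\theta\in[0,\pi]$, $R,\Sigma>0$, $H>0$ for $\theta\in(0,\pi)$ and $H=G=0$ at $\theta=0,\pi$. $S=\{t=t_0,r=r_0\}$ is a spacelike sphere with induced metric $\Sigma^2d\theta^2+H\,d\phi^2$. Its mean curvature along the radial outer normal $\frac1R\partial_r$ is \[k=-\left(H^{-1}\langle\nabla_{\partial_\phi}\partial_\phi,\tfrac1R\partial_r\rangle+\Sigma^{-2}\langle\nabla_{\partial_\theta}\partial_\theta,\tfrac1R\partial_r\rangle\right)=\frac{(\sqrt H\Sigma)_r}{\sqrt H R\Sigma}.\] For smooth functions $x,y$ on $[0,\pi]$ with $x'(0)=x'(\pi)=y(0)=y(\pi)=0$,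 the (Chen-Nester-Tung) energy functional is $E(x,y)=\frac14\int_0^\pi\mathfrak B(x,y)\,d\theta$ with \[\begin{split}\mathfrak B(x,y)=&-\frac{\alpha(H\Sigma^2)_r}{2\sqrt H R^2\Sigma^2}-\sqrt H\left(\frac{H_{\theta\theta}-2l}{\beta}+\frac{R_\theta xy}{R\alpha}-\frac{xy^3\beta+H_\theta\alpha\Sigma^2}{l\alpha\beta\Sigma}\Sigma_\theta\right)\\&+\frac{\sqrt H\,y\,x_\theta}{\alpha}+\frac{\sqrt H\,y(H_\theta\alpha-xy\beta)}{l\alpha\beta}y_\theta,\end{split}\] \[\alpha=\sqrt{x^2\Sigma^2+R^2l},\qquad\beta=\sqrt{-H_\theta^2+4Hl},\qquad l=y^2+\Sigma^2,\] where all metric functions and their derivatives are evaluated at $r=r_0$, and subscripts $r,\theta$ denote partial derivatives. It is understood that $4H\Sigma^2-H_\theta^2>0$ on $(0,\pi)$ at $r=r_0$, so that $\beta$ and $K$ are real and $\mathfrak B$ is defined near $(0,0)$. The pair $(0,0)$ is a critical point of $E$. The second variation is $\delta^2E_{(0,0)}(\xi,\zeta)=\frac{d^2}{d\epsilon^2}\big|_{\epsilon=0}E(\epsilon\xi,\epsilon\zeta)$; "saddle critical point" means a critical point at which the second variation takes both negative and positive values on admissible smooth variations (those with $\xi'(0)=\xi'(\pi)=\zeta(0)=\zeta(\pi)=0$). *)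

theory Defs
  imports "HOL-Analysis.Analysis"
begin

section \<open>Smoothness\<close>

text \<open>
  Only used for \<^term>\<open>S\<close> open, or a non-degenerate compact real interval. There the
  derivative within \<^term>\<open>S\<close> is unique; at the endpoints of an interval it is the one-sided one.
\<close>

primrec times_diff_on :: "nat \<Rightarrow> 'a::real_normed_vector set \<Rightarrow> ('a \<Rightarrow> 'b::real_normed_vector) \<Rightarrow> bool" where
  "times_diff_on 0 S f \<longleftrightarrow> continuous_on S f"
| "times_diff_on (Suc n) S f \<longleftrightarrow>
     (\<forall>x\<in>S. f differentiable (at x within S)) \<and>
     (\<forall>v. times_diff_on n S (\<lambda>x. frechet_derivative f (at x within S) v))"

definition smooth_on :: "'a::real_normed_vector set \<Rightarrow> ('a \<Rightarrow> 'b::real_normed_vector) \<Rightarrow> bool" where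
  "smooth_on S f \<longleftrightarrow> (\<forall>n. times_diff_on n S f)"

section \<open>Kerr-like metrics\<close>

text \<open>
  Coordinates are ordered \<open>(t, r, \<theta>, \<phi>)\<close>, with indices 1, 2, 3, 4. The metric functions are
  functions of \<open>r\<close> and \<open>\<theta>\<close>, in this order, and \<open>Sig\<close> is the function written \<open>\<Sigma>\<close> on paper.
\<close>

definition kerr_like_matrix ::
  "(real \<Rightarrow> real \<Rightarrow> real) \<Rightarrow> (real \<Rightarrow> real \<Rightarrow> real) \<Rightarrow> (real \<Rightarrow> real \<Rightarrow> real) \<Rightarrow>
   (real \<Rightarrow> real \<Rightarrow> real) \<Rightarrow> (real \<Rightarrow> real \<Rightarrow> real) \<Rightarrow> real^4 \<Rightarrow> real^4^4" where
  "kerr_like_matrix F G H R Sig q =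
     (let r = q $ 2; \<theta> = q $ 3 in
      vector [vector [F r \<theta>, 0, 0, G r \<theta>],
              vector [0, (R r \<theta>)\<^sup>2, 0, 0],
              vector [0, 0, (Sig r \<theta>)\<^sup>2, 0],
              vector [G r \<theta>, 0, 0, H r \<theta>]])"

definition lorentzian :: "real^4^4 \<Rightarrow> bool" where
  "lorentzian A \<longleftrightarrow>
     (\<exists>P::real^4^4. invertible P \<and>
        transpose P ** A ** P = (\<chi> i j. if i = j then (if i = 1 then -1 else 1) else 0))"

text \<open>
  The spacetime is \<open>\<real> \<times> J \<times> S\<^sup>2\<close>, where \<open>J\<close> is the open range of the coordinate \<open>r\<close>. To express
  smoothness of the metric across the axis \<open>\<theta> = 0, \<pi>\<close>, where \<open>(\<theta>, \<phi>)\<close> degenerate, this manifold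
  is identified with an open subset of \<open>\<real> \<times> \<real>\<^sup>3\<close> by sending \<open>(t, r, \<omega>)\<close> to \<open>(t, e\<^sup>r \<omega>)\<close>.
  The exponential only serves to allow an arbitrary \<open>J\<close>; it carries no geometric meaning.
\<close>

definition sph_chart :: "real^4 \<Rightarrow> real^4" where
  "sph_chart q =
     vector [q $ 1,
             exp (q $ 2) * sin (q $ 3) * cos (q $ 4),
             exp (q $ 2) * sin (q $ 3) * sin (q $ 4),
             exp (q $ 2) * cos (q $ 3)]"

definition spacetime :: "real set \<Rightarrow> (real^4) set" where
  "spacetime J = {X. sqrt ((X $ 2)\<^sup>2 + (X $ 3)\<^sup>2 + (X $ 4)\<^sup>2) \<in> exp ` J}"

definition pullback_metric :: "(real^4 \<Rightarrow> real^4) \<Rightarrow> (real^4 \<Rightarrow> real^4^4) \<Rightarrow> real^4 \<Rightarrow> real^4^4" where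
  "pullback_metric \<Phi> g q =
     (let D = matrix (frechet_derivative \<Phi> (at q)) in transpose D ** g (\<Phi> q) ** D)"

definition kerr_like_metric ::
  "real set \<Rightarrow> (real \<Rightarrow> real \<Rightarrow> real) \<Rightarrow> (real \<Rightarrow> real \<Rightarrow> real) \<Rightarrow> (real \<Rightarrow> real \<Rightarrow> real) \<Rightarrow>
   (real \<Rightarrow> real \<Rightarrow> real) \<Rightarrow> (real \<Rightarrow> real \<Rightarrow> real) \<Rightarrow> bool" where
  "kerr_like_metric J F G H R Sig \<longleftrightarrow>
     open J \<and>
     (\<forall>r\<in>J. \<forall>\<theta>\<in>{0..pi}. R r \<theta> > 0 \<and> Sig r \<theta> > 0) \<and>
     (\<forall>r\<in>J. \<forall>\<theta>\<in>{0<..<pi}. H r \<theta> > 0) \<and>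
     (\<forall>r\<in>J. \<forall>\<theta>\<in>{0, pi}. H r \<theta> = 0 \<and> G r \<theta> = 0) \<and>
     (\<exists>g. (\<forall>i j. smooth_on (spacetime J) (\<lambda>X. g X $ i $ j)) \<and>
          (\<forall>X\<in>spacetime J. lorentzian (g X)) \<and>
          (\<forall>q. q $ 2 \<in> J \<and> q $ 3 \<in> {0..pi} \<longrightarrow>
             pullback_metric sph_chart g q = kerr_like_matrix F G H R Sig q))"

section \<open>Mean curvature and the function \<open>K\<close>\<close>

definition partial :: "4 \<Rightarrow> (real^4 \<Rightarrow> real) \<Rightarrow> real^4 \<Rightarrow> real" where
  "partial c f q = deriv (\<lambda>s. f (q + s *\<^sub>R axis c 1)) 0"

text \<open>
  Koszul formula for coordinate fields: this is \<open>\<langle>\<nabla>\<^sub>a \<partial>\<^sub>b, \<partial>\<^sub>c\<rangle>\<close> for the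
  Levi-Civita connection of the metric with coordinate matrix \<open>m\<close>.
\<close>

definition christoffel_first :: "(real^4 \<Rightarrow> real^4^4) \<Rightarrow> 4 \<Rightarrow> 4 \<Rightarrow> 4 \<Rightarrow> real^4 \<Rightarrow> real" where
  "christoffel_first m a b c q =
     (partial a (\<lambda>p. m p $ b $ c) q + partial b (\<lambda>p. m p $ a $ c) q - partial c (\<lambda>p. m p $ a $ b) q) / 2"

text \<open>Extension to the poles by continuity of a function given on \<open>(0, \<pi>)\<close>.\<close>

definition pole_ext :: "(real \<Rightarrow> real) \<Rightarrow> real \<Rightarrow> real" where
  "pole_ext f \<theta> = (if \<theta> \<in> {0<..<pi} then f \<theta> else Lim (at \<theta> within {0<..<pi}) f)"

definition mean_curvature ::
  "(real \<Rightarrow> real \<Rightarrow> real) \<Rightarrow> (real \<Rightarrow> real \<Rightarrow> real) \<Rightarrow> (real \<Rightarrow> real \<Rightarrow> real) \<Rightarrow>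
   (real \<Rightarrow> real \<Rightarrow> real) \<Rightarrow> (real \<Rightarrow> real \<Rightarrow> real) \<Rightarrow> real \<Rightarrow> real \<Rightarrow> real \<Rightarrow> real \<Rightarrow> real" where
  "mean_curvature F G H R Sig t r \<phi> =
     pole_ext (\<lambda>\<theta>.
       let \<Gamma> = (\<lambda>a b c. christoffel_first (kerr_like_matrix F G H R Sig) a b c (vector [t, r, \<theta>, \<phi>])) in
       - (1 / H r \<theta> * (1 / R r \<theta> * \<Gamma> 4 4 2) + 1 / (Sig r \<theta>)\<^sup>2 * (1 / R r \<theta> * \<Gamma> 3 3 2)))"

text \<open>The derivative in \<open>\<theta>\<close> of a function on \<open>[0, \<pi>]\<close>, one-sided at the poles.\<close>

definition dth :: "(real \<Rightarrow> real) \<Rightarrow> real \<Rightarrow> real" where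
  "dth f \<theta> = vector_derivative f (at \<theta> within {0..pi})"

definition K_fun ::
  "(real \<Rightarrow> real \<Rightarrow> real) \<Rightarrow> (real \<Rightarrow> real \<Rightarrow> real) \<Rightarrow> (real \<Rightarrow> real \<Rightarrow> real) \<Rightarrow> real \<Rightarrow> real \<Rightarrow> real" where
  "K_fun H R Sig r\<^sub>0 =
     pole_ext (\<lambda>\<theta>.
       - deriv (\<lambda>r. sqrt (H r \<theta>) * Sig r \<theta>) r\<^sub>0 / (2 * R r\<^sub>0 \<theta>)
       + Sig r\<^sub>0 \<theta> * sqrt (1 - (dth (H r\<^sub>0) \<theta>)\<^sup>2 / (4 * H r\<^sub>0 \<theta> * (Sig r\<^sub>0 \<theta>)\<^sup>2)) / 2 * (sin \<theta>)\<^sup>2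
       + dth (H r\<^sub>0) \<theta> / (4 * sqrt (H r\<^sub>0 \<theta>)) * cos \<theta> * sin \<theta>
       + sqrt (H r\<^sub>0 \<theta>) / 2)"

section \<open>The energy functional\<close>

text \<open>The values of the density at \<open>\<theta> = 0, \<pi>\<close>, where it is a quotient with vanishing
  denominator, are irrelevant to the integral.\<close>

definition cnt_density ::
  "(real \<Rightarrow> real \<Rightarrow> real) \<Rightarrow> (real \<Rightarrow> real \<Rightarrow> real) \<Rightarrow> (real \<Rightarrow> real \<Rightarrow> real) \<Rightarrow> real \<Rightarrow>
   (real \<Rightarrow> real) \<Rightarrow> (real \<Rightarrow> real) \<Rightarrow> real \<Rightarrow> real" where
  "cnt_density H R Sig r\<^sub>0 x y \<theta> =
     (let h = H r\<^sub>0 \<theta>; \<rho> = R r\<^sub>0 \<theta>; \<sigma> = Sig r\<^sub>0 \<theta>;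
          h\<^sub>\<theta> = dth (H r\<^sub>0) \<theta>; h\<^sub>\<theta>\<^sub>\<theta> = dth (dth (H r\<^sub>0)) \<theta>;
          \<rho>\<^sub>\<theta> = dth (R r\<^sub>0) \<theta>; \<sigma>\<^sub>\<theta> = dth (Sig r\<^sub>0) \<theta>;
          l = (y \<theta>)\<^sup>2 + \<sigma>\<^sup>2;
          \<alpha> = sqrt ((x \<theta>)\<^sup>2 * \<sigma>\<^sup>2 + \<rho>\<^sup>2 * l);
          \<beta> = sqrt (- h\<^sub>\<theta>\<^sup>2 + 4 * h * l)
      in - (\<alpha> * deriv (\<lambda>r. H r \<theta> * (Sig r \<theta>)\<^sup>2) r\<^sub>0) / (2 * sqrt h * \<rho>\<^sup>2 * \<sigma>\<^sup>2)
         - sqrt h * ((h\<^sub>\<theta>\<^sub>\<theta> - 2 * l) / \<beta> + \<rho>\<^sub>\<theta> * x \<theta> * y \<theta> / (\<rho> * \<alpha>)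
                     - (x \<theta> * (y \<theta>) ^ 3 * \<beta> + h\<^sub>\<theta> * \<alpha> * \<sigma>\<^sup>2) / (l * \<alpha> * \<beta> * \<sigma>) * \<sigma>\<^sub>\<theta>)
         + sqrt h * y \<theta> * dth x \<theta> / \<alpha>
         + sqrt h * y \<theta> * (h\<^sub>\<theta> * \<alpha> - x \<theta> * y \<theta> * \<beta>) / (l * \<alpha> * \<beta>) * dth y \<theta>)"

definition energy ::
  "(real \<Rightarrow> real \<Rightarrow> real) \<Rightarrow> (real \<Rightarrow> real \<Rightarrow> real) \<Rightarrow> (real \<Rightarrow> real \<Rightarrow> real) \<Rightarrow> real \<Rightarrow>
   (real \<Rightarrow> real) \<Rightarrow> (real \<Rightarrow> real) \<Rightarrow> real" where
  "energy H R Sig r\<^sub>0 x y = 1 / 4 * integral {0..pi} (cnt_density H R Sig r\<^sub>0 x y)"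

section \<open>Saddle critical points\<close>

definition admissible :: "(real \<Rightarrow> real) \<Rightarrow> (real \<Rightarrow> real) \<Rightarrow> bool" where
  "admissible x y \<longleftrightarrow>
     smooth_on {0..pi} x \<and> smooth_on {0..pi} y \<and>
     dth x 0 = 0 \<and> dth x pi = 0 \<and> y 0 = 0 \<and> y pi = 0"

definition critical_at_zero :: "((real \<Rightarrow> real) \<Rightarrow> (real \<Rightarrow> real) \<Rightarrow> real) \<Rightarrow> bool" where
  "critical_at_zero E \<longleftrightarrow>
     (\<forall>\<xi> \<zeta>. admissible \<xi> \<zeta> \<longrightarrow>
        ((\<lambda>\<epsilon>. E (\<lambda>\<theta>. \<epsilon> * \<xi> \<theta>) (\<lambda>\<theta>. \<epsilon> * \<zeta> \<theta>)) has_real_derivative 0) (at 0))"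

text \<open>A relation rather than a value \<open>deriv (deriv _) 0\<close>, so that the existence of the second
  derivative is part of the claim.\<close>

definition has_second_variation_at_zero ::
  "((real \<Rightarrow> real) \<Rightarrow> (real \<Rightarrow> real) \<Rightarrow> real) \<Rightarrow> (real \<Rightarrow> real) \<Rightarrow> (real \<Rightarrow> real) \<Rightarrow> real \<Rightarrow> bool" where
  "has_second_variation_at_zero E \<xi> \<zeta> D \<longleftrightarrow>
     (\<exists>E'. (\<forall>\<^sub>F \<epsilon> in nhds 0.
              ((\<lambda>e. E (\<lambda>\<theta>. e * \<xi> \<theta>) (\<lambda>\<theta>. e * \<zeta> \<theta>)) has_real_derivative E' \<epsilon>) (at \<epsilon>)) \<and>
           (E' has_real_derivative D) (at 0))"

definition saddle_critical_at_zero :: "((real \<Rightarrow> real) \<Rightarrow> (real \<Rightarrow> real) \<Rightarrow> real) \<Rightarrow> bool" where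
  "saddle_critical_at_zero E \<longleftrightarrow>
     critical_at_zero E \<and>
     (\<exists>\<xi> \<zeta> D. admissible \<xi> \<zeta> \<and> has_second_variation_at_zero E \<xi> \<zeta> D \<and> D < 0) \<and>
     (\<exists>\<xi> \<zeta> D. admissible \<xi> \<zeta> \<and> has_second_variation_at_zero E \<xi> \<zeta> D \<and> D > 0)"

end

theory Submission
  imports Defs
begin

text \<open>
  Put \<open>f = \<surd>H\<close>, \<open>p = f\<^sub>\<theta>\<close>, \<open>l = y\<^sup>2 + \<Sigma>\<^sup>2\<close>. Then \<open>\<beta> = 2 f \<surd>(l - p\<^sup>2)\<close>, and the terms of the density
  that are singular at the poles add up to \<open>\<surd>(l - p\<^sup>2) + f \<partial>\<^sub>\<theta> arccos (p / \<surd>l)\<close>. As \<open>f\<close> vanishes at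
  the poles, integration by parts turns them into \<open>\<surd>(l - p\<^sup>2) - p arccos (p / \<surd>l)\<close>, whose derivative
  in \<open>y\<close> is the continuous function \<open>y \<surd>(l - p\<^sup>2) / l\<close>. Hence one may differentiate twice under
  the integral at \<open>(0, 0)\<close>, even where \<open>\<Sigma>\<^sup>2 - p\<^sup>2\<close> vanishes to high order at a pole.

  The second variation is negative at \<open>(1, 0)\<close> because the mean curvature is positive. It is positive
  at \<open>(cos n\<theta>, - sin n\<theta>)\<close> for suitable large \<open>n\<close>: its mixed term \<open>2 f \<zeta> \<xi>\<^sub>\<theta> / (R \<Sigma>)\<close> grows
  linearly in \<open>n\<close>, while all other terms stay bounded.
\<close>

section \<open>Smooth functions of the polar angle\<close>

lemma dth_eqI:
  assumes "(f has_real_derivative d) (at \<theta> within {0..pi})" "\<theta> \<in> {0..pi}"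
  shows "dth f \<theta> = d"
  unfolding dth_def
  using assms by (intro vector_derivative_within_closed_interval)
    (auto simp: has_real_derivative_iff_has_vector_derivative)

lemma has_real_derivative_eq_on:
  assumes "(f has_real_derivative d) (at x within S)" "x \<in> S" "\<And>t. t \<in> S \<Longrightarrow> f t = g t"
  shows "(g has_real_derivative d) (at x within S)"
  by (rule has_field_derivative_transform_within[OF assms(1), of 1]) (use assms in auto)

lemma dth_square:
  assumes "(f has_real_derivative p) (at \<theta> within {0..pi})" "\<And>t. t \<in> {0..pi} \<Longrightarrow> h t = (f t)\<^sup>2"
    "\<theta> \<in> {0..pi}"
  shows "dth h \<theta> = 2 * f \<theta> * p"
proof (rule dth_eqI[OF _ assms(3)])
  have "((\<lambda>\<theta>. (f \<theta>)\<^sup>2) has_real_derivative 2 * f \<theta> * p) (at \<theta> within {0..pi})"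
    using assms(1) by (auto intro!: derivative_eq_intros)
  then show "(h has_real_derivative 2 * f \<theta> * p) (at \<theta> within {0..pi})"
    by (rule has_real_derivative_eq_on[OF _ assms(3)]) (use assms(2) in auto)
qed

lemma has_real_derivative_dth:
  assumes "f differentiable (at \<theta> within {0..pi})"
  shows "(f has_real_derivative dth f \<theta>) (at \<theta> within {0..pi})"
  using assms unfolding dth_def
  by (simp add: has_real_derivative_iff_has_vector_derivative vector_derivative_works)

lemma smooth_on_Icc_has_derivative:
  assumes "smooth_on {0..pi} x" "\<theta> \<in> {0..pi}"
  shows "(x has_real_derivative dth x \<theta>) (at \<theta> within {0..pi})"
proof -
  have "times_diff_on (Suc 0) {0..pi} x" using assms(1) by (simp only: smooth_on_def)
  then show ?thesis using assms(2) by (auto intro: has_real_derivative_dth)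
qed

text \<open>Smoothness is phrased through \<open>frechet_derivative\<close>, while the density uses
  \<open>dth\<close>. The derivative within a nondegenerate interval is unique, so its value in
  direction \<open>1\<close> is \<open>dth x\<close> and continuity transfers.\<close>

lemma smooth_on_Icc_continuous_dth:
  fixes x :: "real \<Rightarrow> real"
  assumes "smooth_on {0..pi} x"
  shows "continuous_on {0..pi} (dth x)"
proof -
  have "times_diff_on (Suc 0) {0..pi} x" using assms by (simp only: smooth_on_def)
  then have "continuous_on {0..pi} (\<lambda>\<theta>. frechet_derivative x (at \<theta> within {0..pi}) 1)"
    and diff: "\<And>\<theta>. \<theta> \<in> {0..pi} \<Longrightarrow> x differentiable (at \<theta> within {0..pi})"
    by auto
  moreover have "frechet_derivative x (at \<theta> within {0..pi}) 1 = dth x \<theta>" if "\<theta> \<in> {0..pi}" for \<theta>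
  proof -
    have "(x has_derivative frechet_derivative x (at \<theta> within {0..pi})) (at \<theta> within {0..pi})"
      using diff[OF that] by (simp add: frechet_derivative_works)
    moreover have "(x has_derivative (*) (dth x \<theta>)) (at \<theta> within {0..pi})"
      using has_real_derivative_dth[OF diff[OF that]] by (simp add: has_field_derivative_def)
    ultimately have "frechet_derivative x (at \<theta> within {0..pi}) = (*) (dth x \<theta>)"
      using that by (intro frechet_derivative_unique_within_closed_interval[of 0 pi]) auto
    then show ?thesis by simp
  qed
  ultimately show ?thesis by (metis (no_types, lifting) continuous_on_cong)
qed

text \<open>A derivative within \<open>S\<close> at a point of \<open>S\<close> sees only values on
  \<open>S\<close>, so agreement on \<open>S\<close> passes through each step of the recursion. This
  allows derivative formulas valid only on \<open>S\<close> to be substituted under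
  \<open>times_diff_on\<close>.\<close>

lemma times_diff_on_cong:
  assumes "\<And>x. x \<in> S \<Longrightarrow> f x = g x"
  shows "times_diff_on k S f \<longleftrightarrow> times_diff_on k S g"
  using assms
proof (induction k arbitrary: f g)
  case 0
  then have "continuous_on S f \<longleftrightarrow> continuous_on S g"
    by (intro continuous_on_cong) auto
  then show ?case by simp
next
  case (Suc k)
  have dg: "(f has_derivative f') (at x within S) \<longleftrightarrow> (g has_derivative f') (at x within S)"
    if "x \<in> S" for x f'
    using that has_derivative_transform[OF that, of g f] has_derivative_transform[OF that, of f g] Suc.prems
    by metis
  have "frechet_derivative f (at x within S) = frechet_derivative g (at x within S)"
    if "x \<in> S" for x
    using dg[OF that] by (simp add: frechet_derivative_def)
  then have "times_diff_on k S (\<lambda>x. frechet_derivative f (at x within S) v) \<longleftrightarrow>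
    times_diff_on k S (\<lambda>x. frechet_derivative g (at x within S) v)" for v
    by (intro Suc.IH) auto
  then show ?case using dg by (simp add: differentiable_def)
qed

text \<open>The derivative of a multiple is the same multiple of the derivative, so the induction
  runs over all functions at once. It makes the integral identities available along the rays
  \<open>\<epsilon> * \<xi> \<theta>\<close>.\<close>

lemma smooth_on_Icc_cmult:
  fixes x :: "real \<Rightarrow> real"
  assumes "smooth_on {0..pi} x"
  shows "smooth_on {0..pi} (\<lambda>\<theta>. a * x \<theta>)"
proof -
  have "times_diff_on k {0..pi} (\<lambda>\<theta>. a * x \<theta>)" if "times_diff_on k {0..pi} x"
    for k and x :: "real \<Rightarrow> real"
    using that
  proof (induction k arbitrary: x)
    case 0
    then show ?case by (auto intro!: continuous_intros)
  next
    case (Suc k)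
    have D: "((\<lambda>\<theta>. a * x \<theta>) has_derivative (\<lambda>v. a * frechet_derivative x (at \<theta> within {0..pi}) v))
        (at \<theta> within {0..pi})" if "\<theta> \<in> {0..pi}" for \<theta>
      using Suc.prems that by (intro has_derivative_mult_right) (auto simp: frechet_derivative_works[symmetric])
    have F: "frechet_derivative (\<lambda>\<theta>. a * x \<theta>) (at \<theta> within {0..pi}) =
        (\<lambda>v. a * frechet_derivative x (at \<theta> within {0..pi}) v)" if "\<theta> \<in> {0..pi}" for \<theta>
      using that D[OF that] frechet_derivative_works differentiable_def
      by (intro frechet_derivative_unique_within_closed_interval[of 0 pi]) (auto, blast+)
    have "times_diff_on k {0..pi} (\<lambda>\<theta>. frechet_derivative (\<lambda>\<theta>. a * x \<theta>) (at \<theta> within {0..pi}) v)" for v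
      by (rule iffD2[OF times_diff_on_cong[OF fun_cong[OF F]] Suc.IH]) (use Suc.prems in auto)
    moreover have "(\<lambda>\<theta>. a * x \<theta>) differentiable (at \<theta> within {0..pi})" if "\<theta> \<in> {0..pi}" for \<theta>
      using D[OF that] by (rule differentiableI)
    ultimately show ?case by simp
  qed
  then show ?thesis using assms by (simp add: smooth_on_def)
qed

text \<open>The family is closed under differentiation, with the direction \<open>v\<close> absorbed
  into the coefficients; hence the induction with arbitrary coefficients. The summand
  \<open>c\<close> makes constant variations a special case.\<close>

lemma smooth_on_Icc_trig:
  "smooth_on {0..pi} (\<lambda>\<theta>. a * cos (n * \<theta>) + b * sin (n * \<theta>) + (c::real))"
proof -
  have "times_diff_on k {0..pi} (\<lambda>\<theta>. a * cos (n * \<theta>) + b * sin (n * \<theta>) + (c::real))" for k a b c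
  proof (induction k arbitrary: a b c)
    case 0
    show ?case by (auto intro!: continuous_intros)
  next
    case (Suc k)
    let ?u = "\<lambda>\<theta>. a * cos (n * \<theta>) + b * sin (n * \<theta>) + c"
    have D: "(?u has_derivative (\<lambda>v. (b * n * v) * cos (n * \<theta>) + (- a * n * v) * sin (n * \<theta>) + 0))
        (at \<theta> within {0..pi})" for \<theta>
      by (auto intro!: derivative_eq_intros simp: algebra_simps)
    have F: "frechet_derivative ?u (at \<theta> within {0..pi}) =
        (\<lambda>v. (b * n * v) * cos (n * \<theta>) + (- a * n * v) * sin (n * \<theta>) + 0)" if "\<theta> \<in> {0..pi}" for \<theta>
      using that D frechet_derivative_works differentiable_def
      by (intro frechet_derivative_unique_within_closed_interval[of 0 pi]) (auto, blast+)
    have "times_diff_on k {0..pi} (\<lambda>\<theta>. frechet_derivative ?u (at \<theta> within {0..pi}) v)" for v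
      by (rule iffD2[OF times_diff_on_cong[OF fun_cong[OF F]] Suc.IH])
    moreover have "?u differentiable (at \<theta> within {0..pi})" for \<theta>
      using D differentiable_def by blast
    ultimately show ?case by simp
  qed
  then show ?thesis by (simp add: smooth_on_def)
qed

lemma pi_interior:
  "\<theta> \<in> {0<..<pi} \<Longrightarrow> at \<theta> within {0..pi} = at \<theta>" "\<theta> \<in> {0<..<pi} \<Longrightarrow> \<theta> \<in> {0..pi}"
  by (auto simp: at_within_Icc_at)

section \<open>The energy density\<close>

text \<open>The left side is the density for \<open>H = f\<^sup>2\<close>, whose first and second
  \<theta>-derivatives are \<open>2 * f * p\<close> and \<open>2 * p\<^sup>2 + 2 * f * p2\<close>,
  with \<open>f * M\<close> in place of the r-derivative of H Sig^2. The prefactor \<open>f\<close>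
  cancels the one in \<open>\<beta> = 2 * f * W\<close>. The last summand on the right is
  \<open>f\<close> times the \<theta>-derivative of \<open>arccos (p / sqrt l)\<close>.\<close>

lemma density_identity:
  fixes f p p2 \<rho> \<rho>1 \<sigma> \<sigma>1 M x x1 y y1 :: real
  assumes "f > 0" "\<rho> > 0" "\<sigma> > 0" "p\<^sup>2 < l"
    and l: "l = y\<^sup>2 + \<sigma>\<^sup>2"
    and \<alpha>: "\<alpha> = sqrt (x\<^sup>2 * \<sigma>\<^sup>2 + \<rho>\<^sup>2 * l)"
    and W: "W = sqrt (l - p\<^sup>2)"
    and \<beta>: "\<beta> = sqrt (- (2 * f * p)\<^sup>2 + 4 * f\<^sup>2 * l)"
  shows "- (\<alpha> * (f * M)) / (2 * sqrt (f\<^sup>2) * \<rho>\<^sup>2 * \<sigma>\<^sup>2)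
         - sqrt (f\<^sup>2) * ((2 * p\<^sup>2 + 2 * f * p2 - 2 * l) / \<beta> + \<rho>1 * x * y / (\<rho> * \<alpha>)
                     - (x * y ^ 3 * \<beta> + 2 * f * p * \<alpha> * \<sigma>\<^sup>2) / (l * \<alpha> * \<beta> * \<sigma>) * \<sigma>1)
         + sqrt (f\<^sup>2) * y * x1 / \<alpha>
         + sqrt (f\<^sup>2) * y * (2 * f * p * \<alpha> - x * y * \<beta>) / (l * \<alpha> * \<beta>) * y1
       = - \<alpha> * M / (2 * \<rho>\<^sup>2 * \<sigma>\<^sup>2) + W
         + f * (x1 * y - \<rho>1 * x * y / \<rho> + x * y ^ 3 * \<sigma>1 / (l * \<sigma>) - x * y\<^sup>2 * y1 / l) / \<alpha>
         + f * (p * (y * y1 + \<sigma> * \<sigma>1) / (l * W) - p2 / W)"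
proof -
  have l0: "l > 0" using assms by (simp add: add_nonneg_pos)
  have \<alpha>0: "\<alpha> > 0" unfolding \<alpha> using l0 \<open>\<rho> > 0\<close> by (simp add: add_nonneg_pos)
  have W0: "W > 0" unfolding W using \<open>p\<^sup>2 < l\<close> by simp
  have "- (2 * f * p)\<^sup>2 + 4 * f\<^sup>2 * l = (2 * f)\<^sup>2 * (l - p\<^sup>2)"
    by (simp add: power2_eq_square algebra_simps)
  then have b: "\<beta> = 2 * f * W" using \<open>f > 0\<close> unfolding \<beta> W by (simp add: real_sqrt_mult)
  have p2: "p\<^sup>2 = l - W\<^sup>2" unfolding W using \<open>p\<^sup>2 < l\<close> by simp
  have 1: "- (\<alpha> * (f * M)) / (2 * f * \<rho>\<^sup>2 * \<sigma>\<^sup>2) = - \<alpha> * M / (2 * \<rho>\<^sup>2 * \<sigma>\<^sup>2)"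
    using \<open>f > 0\<close> by simp
  \<comment> \<open>Since \<open>p\<^sup>2 - l = - W\<^sup>2\<close>, the part without
    \<open>p2\<close> becomes \<open>- W\<close>, which is harmless at the poles although
    \<open>\<beta>\<close> vanishes there.\<close>
  have 2: "f * ((2 * p\<^sup>2 + 2 * f * p2 - 2 * l) / \<beta>) = f * p2 / W - W"
    unfolding b p2 using \<open>f > 0\<close> W0 by (simp add: divide_simps) (simp add: power2_eq_square algebra_simps)
  have 3: "f * ((x * y ^ 3 * \<beta> + 2 * f * p * \<alpha> * \<sigma>\<^sup>2) / (l * \<alpha> * \<beta> * \<sigma>) * \<sigma>1)
      = f * (x * y ^ 3 * \<sigma>1 / (l * \<sigma>)) / \<alpha> + f * (p * (\<sigma> * \<sigma>1) / (l * W))"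
    unfolding b using \<open>f > 0\<close> \<open>\<sigma> > 0\<close> W0 l0 \<alpha>0
    by (simp add: divide_simps) (simp add: power2_eq_square algebra_simps)
  have 4: "f * y * (2 * f * p * \<alpha> - x * y * \<beta>) / (l * \<alpha> * \<beta>) * y1
      = f * (p * (y * y1) / (l * W)) - f * (x * y\<^sup>2 * y1 / l) / \<alpha>"
    unfolding b using \<open>f > 0\<close> W0 l0 \<alpha>0
    by (simp add: divide_simps) (simp add: power2_eq_square algebra_simps)
  have 5: "f * y * x1 / \<alpha> = f * (x1 * y) / \<alpha>" "f * (\<rho>1 * x * y / (\<rho> * \<alpha>)) = f * (\<rho>1 * x * y / \<rho>) / \<alpha>"
    by (simp_all add: field_simps)
  have sq: "sqrt (f\<^sup>2) = f" using \<open>f > 0\<close> by simp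
  have distr: "f * (a / \<beta> + c - d) = f * (a / \<beta>) + f * c - f * d" for a c d
    by (simp add: algebra_simps)
  show ?thesis
    unfolding sq distr 1 2 3 4 5 by (simp add: ring_distribs add_divide_distrib diff_divide_distrib)
qed

text \<open>The root and the arccosine each contribute a term with \<open>1 / W\<close>; together
  they give \<open>W / l\<close>, which stays bounded as \<open>W\<close> tends to 0. The
  alternative \<open>z = 0\<close> serves the poles, where \<open>p\<^sup>2 = s\<^sup>2\<close> may
  occur: there the function is constant in \<epsilon>.\<close>

lemma has_real_derivative_sqrt_arccos:
  fixes p z s \<epsilon> :: real
  assumes "s > 0" "p\<^sup>2 < s\<^sup>2 \<or> z = 0"
  shows "((\<lambda>\<epsilon>. sqrt (\<epsilon>\<^sup>2 * z\<^sup>2 + s\<^sup>2 - p\<^sup>2) - p * arccos (p / sqrt (\<epsilon>\<^sup>2 * z\<^sup>2 + s\<^sup>2)))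
    has_real_derivative \<epsilon> * (z\<^sup>2 * sqrt (\<epsilon>\<^sup>2 * z\<^sup>2 + s\<^sup>2 - p\<^sup>2) / (\<epsilon>\<^sup>2 * z\<^sup>2 + s\<^sup>2))) (at \<epsilon>)"
proof (cases "z = 0")
  case False
  then have "p\<^sup>2 < s\<^sup>2" using assms by simp
  define l where "l = \<epsilon>\<^sup>2 * z\<^sup>2 + s\<^sup>2"
  define W where "W = sqrt (l - p\<^sup>2)"
  have l: "p\<^sup>2 < l" "l > 0"
    using \<open>p\<^sup>2 < s\<^sup>2\<close> assms unfolding l_def by (auto intro: add_nonneg_pos add_nonneg_pos[THEN less_le_trans] simp: add_strict_increasing2)
  then have W: "W > 0" "W\<^sup>2 = l - p\<^sup>2" unfolding W_def by auto
  have "\<bar>p\<bar> < sqrt l" using l by (simp add: real_less_rsqrt)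
  then have pl: "-1 < p / sqrt l" "p / sqrt l < 1" using l by (auto simp: divide_simps abs_less_iff)
  have "1 - (p / sqrt l)\<^sup>2 = (W / sqrt l)\<^sup>2"
    using l W by (simp add: power_divide field_simps)
  then have sq: "sqrt (1 - (p / sqrt l)\<^sup>2) = W / sqrt l" using W l by simp
  have dl: "((\<lambda>\<epsilon>. \<epsilon>\<^sup>2 * z\<^sup>2 + s\<^sup>2) has_real_derivative 2 * \<epsilon> * z\<^sup>2) (at \<epsilon>)"
    by (auto intro!: derivative_eq_intros)
  have dW: "((\<lambda>\<epsilon>. sqrt (\<epsilon>\<^sup>2 * z\<^sup>2 + s\<^sup>2 - p\<^sup>2)) has_real_derivative \<epsilon> * z\<^sup>2 / W) (at \<epsilon>)"
    by (rule derivative_eq_intros dl refl | use l in \<open>simp add: l_def W_def divide_simps\<close>)+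
  have dq: "((\<lambda>\<epsilon>. p / sqrt (\<epsilon>\<^sup>2 * z\<^sup>2 + s\<^sup>2)) has_real_derivative - (p * (\<epsilon> * z\<^sup>2) / (l * sqrt l))) (at \<epsilon>)"
    by (rule derivative_eq_intros dl refl | use l in \<open>simp add: l_def[symmetric] divide_simps\<close>)+
  have da: "((\<lambda>\<epsilon>. arccos (p / sqrt (\<epsilon>\<^sup>2 * z\<^sup>2 + s\<^sup>2))) has_real_derivative
      inverse (- sqrt (1 - (p / sqrt l)\<^sup>2)) * (- (p * (\<epsilon> * z\<^sup>2) / (l * sqrt l)))) (at \<epsilon>)"
    using DERIV_chain2[OF DERIV_arccos[OF pl, unfolded l_def] dq] unfolding l_def .
  \<comment> \<open>Both contributions have the factor \<open>\<epsilon> * z\<^sup>2 / W\<close>;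
    the remaining factors add up to \<open>1 - p\<^sup>2 / l = W\<^sup>2 / l\<close>, which removes
    the singularity.\<close>
  have "\<epsilon> * z\<^sup>2 / W - p * (inverse (- sqrt (1 - (p / sqrt l)\<^sup>2)) * (- (p * (\<epsilon> * z\<^sup>2) / (l * sqrt l))))
     = \<epsilon> * z\<^sup>2 * (l - p\<^sup>2) / (l * W)"
    unfolding sq using l W(1) by (simp add: divide_simps) (simp add: power2_eq_square algebra_simps)
  also have "\<dots> = \<epsilon> * (z\<^sup>2 * W / l)"
    unfolding W(2)[symmetric] using W(1) by (simp add: power2_eq_square)
  finally show ?thesis
    using DERIV_diff[OF dW DERIV_cmult[OF da, of p]] unfolding W_def l_def by simp
qed auto

text \<open>The function is even in \<epsilon>, so a factor \<epsilon> can be pulled out of its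
  derivative. Keeping that factor visible lets the second derivative at 0 be read off later without
  differentiating the rest.\<close>

lemma has_real_derivative_cross_term:
  fixes f c c' a b z s \<epsilon> :: real
  assumes "s > 0" "b > 0" "a \<ge> 0"
    and l: "l = \<epsilon>\<^sup>2 * z\<^sup>2 + s\<^sup>2" and \<alpha>: "\<alpha> = sqrt (\<epsilon>\<^sup>2 * a + b)"
  shows "((\<lambda>\<epsilon>. f * (\<epsilon>\<^sup>2 * c + \<epsilon> ^ 4 * c' / (\<epsilon>\<^sup>2 * z\<^sup>2 + s\<^sup>2)) / sqrt (\<epsilon>\<^sup>2 * a + b)) has_real_derivative
    \<epsilon> * (f * ((2 * c + 4 * \<epsilon>\<^sup>2 * c' / l - 2 * \<epsilon> ^ 4 * c' * z\<^sup>2 / l\<^sup>2) / \<alpha>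
       - (\<epsilon>\<^sup>2 * c + \<epsilon> ^ 4 * c' / l) * a / \<alpha> ^ 3))) (at \<epsilon>)"
proof -
  have l0: "l > 0" using assms by (simp add: add_nonneg_pos)
  have \<alpha>0: "\<epsilon>\<^sup>2 * a + b > 0" "\<alpha> > 0" unfolding \<alpha> using assms by (simp_all add: add_nonneg_pos)
  have d\<alpha>: "((\<lambda>\<epsilon>. sqrt (\<epsilon>\<^sup>2 * a + b)) has_real_derivative \<epsilon> * a / \<alpha>) (at \<epsilon>)"
    by (rule derivative_eq_intros refl | use \<alpha>0 in \<open>simp add: \<alpha> divide_simps\<close>)+
  have dl: "((\<lambda>\<epsilon>. \<epsilon>\<^sup>2 * z\<^sup>2 + s\<^sup>2) has_real_derivative 2 * \<epsilon> * z\<^sup>2) (at \<epsilon>)"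
    by (auto intro!: derivative_eq_intros)
  have dN1: "((\<lambda>\<epsilon>. \<epsilon>\<^sup>2 * c + \<epsilon> ^ 4 * c' / (\<epsilon>\<^sup>2 * z\<^sup>2 + s\<^sup>2)) has_real_derivative
     2 * \<epsilon> * c + (4 * \<epsilon> ^ 3 * c' * l - \<epsilon> ^ 4 * c' * (2 * \<epsilon> * z\<^sup>2)) / (l * l)) (at \<epsilon>)"
    by (rule derivative_eq_intros dl refl | use l0 in \<open>simp add: l[symmetric]\<close>)+
  have e: "2 * \<epsilon> * c + (4 * \<epsilon> ^ 3 * c' * l - \<epsilon> ^ 4 * c' * (2 * \<epsilon> * z\<^sup>2)) / (l * l)
      = \<epsilon> * (2 * c + 4 * \<epsilon>\<^sup>2 * c' / l - 2 * \<epsilon> ^ 4 * c' * z\<^sup>2 / l\<^sup>2)"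
    using l0 by (simp add: field_simps power2_eq_square power3_eq_cube)
  have "(f * (\<epsilon> * Q) * \<alpha> - f * N * (\<epsilon> * a / \<alpha>)) / (\<alpha> * \<alpha>) = \<epsilon> * (f * (Q / \<alpha> - N * a / \<alpha> ^ 3))" for Q N
    using \<alpha>0(2) by (simp add: field_simps power3_eq_cube)
  note q = this
  have "sqrt (\<epsilon>\<^sup>2 * a + b) \<noteq> 0" using \<alpha>0 by (simp add: \<alpha>)
  from DERIV_divide[OF DERIV_cmult[OF dN1[unfolded e], of f] d\<alpha> this]
  show ?thesis unfolding \<alpha>[symmetric] l[symmetric] q .
qed

lemma has_integral_sin_squared:
  fixes n :: real
  assumes "n \<noteq> 0" "a \<le> b"
  shows "((\<lambda>\<theta>. (sin (n * \<theta>))\<^sup>2) has_integral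
    (b - a) / 2 - (sin (2 * n * b) - sin (2 * n * a)) / (4 * n)) {a..b}"
proof -
  let ?F = "\<lambda>\<theta>. \<theta> / 2 - sin (2 * n * \<theta>) / (4 * n)"
  have "((\<lambda>\<theta>. (sin (n * \<theta>))\<^sup>2) has_integral ?F b - ?F a) {a..b}"
  proof (rule fundamental_theorem_of_calculus[OF \<open>a \<le> b\<close>])
    fix \<theta>
    have "(?F has_real_derivative 1 / 2 - cos (2 * (n * \<theta>)) / 2) (at \<theta> within {a..b})"
      using \<open>n \<noteq> 0\<close> by (auto intro!: derivative_eq_intros simp: field_simps)
    moreover have "1 / 2 - cos (2 * (n * \<theta>)) / 2 = (sin (n * \<theta>))\<^sup>2"
      unfolding cos_double_sin by (simp add: diff_divide_distrib)
    ultimately show "(?F has_vector_derivative (sin (n * \<theta>))\<^sup>2) (at \<theta> within {a..b})"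
      by (simp add: has_real_derivative_iff_has_vector_derivative)
  qed
  then show ?thesis by (simp add: diff_divide_distrib algebra_simps)
qed

text \<open>What the variational argument keeps of the metric: \<open>f\<close> is a root of
  \<open>H\<close> that is differentiable up to the poles, \<open>p\<close> and \<open>p2\<close>
  are its derivatives, and \<open>M\<close> is the r-derivative of H Sig^2 divided by
  \<open>f\<close>, continued to the poles. The sign of the mean curvature enters as positivity of
  \<open>M\<close> in the interior.\<close>

locale kerr_sphere =
  fixes H R Sig :: "real \<Rightarrow> real \<Rightarrow> real" and r\<^sub>0 :: real and f p p2 M :: "real \<Rightarrow> real"
  assumes H_eq: "\<And>\<theta>. \<theta> \<in> {0..pi} \<Longrightarrow> H r\<^sub>0 \<theta> = (f \<theta>)\<^sup>2"
    and f_deriv: "\<And>\<theta>. \<theta> \<in> {0..pi} \<Longrightarrow> (f has_real_derivative p \<theta>) (at \<theta> within {0..pi})"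
    and p_deriv: "\<And>\<theta>. \<theta> \<in> {0..pi} \<Longrightarrow> (p has_real_derivative p2 \<theta>) (at \<theta> within {0..pi})"
    and R_deriv: "\<And>\<theta>. \<theta> \<in> {0..pi} \<Longrightarrow>
      (R r\<^sub>0 has_real_derivative dth (R r\<^sub>0) \<theta>) (at \<theta> within {0..pi})"
    and Sig_deriv: "\<And>\<theta>. \<theta> \<in> {0..pi} \<Longrightarrow>
      (Sig r\<^sub>0 has_real_derivative dth (Sig r\<^sub>0) \<theta>) (at \<theta> within {0..pi})"
    and cont_dR: "continuous_on {0..pi} (dth (R r\<^sub>0))"
    and cont_dSig: "continuous_on {0..pi} (dth (Sig r\<^sub>0))"
    and cont_M: "continuous_on {0..pi} M"
    and R_pos: "\<And>\<theta>. \<theta> \<in> {0..pi} \<Longrightarrow> R r\<^sub>0 \<theta> > 0"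
    and Sig_pos: "\<And>\<theta>. \<theta> \<in> {0..pi} \<Longrightarrow> Sig r\<^sub>0 \<theta> > 0"
    and f_pos: "\<And>\<theta>. \<theta> \<in> {0<..<pi} \<Longrightarrow> f \<theta> > 0"
    and f_poles: "f 0 = 0" "f pi = 0"
    and p_less: "\<And>\<theta>. \<theta> \<in> {0<..<pi} \<Longrightarrow> (p \<theta>)\<^sup>2 < (Sig r\<^sub>0 \<theta>)\<^sup>2"
    and M_pos: "\<And>\<theta>. \<theta> \<in> {0<..<pi} \<Longrightarrow> M \<theta> > 0"
    and M_eq: "\<And>\<theta>. \<theta> \<in> {0<..<pi} \<Longrightarrow> deriv (\<lambda>r. H r \<theta> * (Sig r \<theta>)\<^sup>2) r\<^sub>0 = f \<theta> * M \<theta>"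
begin

section \<open>Integration by parts for the energy density\<close>

abbreviation \<rho> where "\<rho> \<equiv> R r\<^sub>0"
abbreviation \<sigma> where "\<sigma> \<equiv> Sig r\<^sub>0"

lemma cont_f: "continuous_on {0..pi} f" and cont_p: "continuous_on {0..pi} p"
  and cont_R: "continuous_on {0..pi} \<rho>" and cont_Sig: "continuous_on {0..pi} \<sigma>"
  by (rule DERIV_continuous_on, erule f_deriv p_deriv R_deriv Sig_deriv)+

text \<open>Continuity carries the strict interior inequality to the poles only as a weak one.
  Equality there is the typical case: for a metric smooth across the axis, \<open>f\<close> behaves
  like \<open>\<sigma>\<close> times the angle to the pole.\<close>

lemma p_le: "\<theta> \<in> {0..pi} \<Longrightarrow> (p \<theta>)\<^sup>2 \<le> (\<sigma> \<theta>)\<^sup>2"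
proof -
  assume "\<theta> \<in> {0..pi}"
  then have "\<theta> \<in> closure {0<..<pi}" by simp
  moreover have "continuous_on (closure {0<..<pi}) (\<lambda>\<theta>. (\<sigma> \<theta>)\<^sup>2 - (p \<theta>)\<^sup>2)"
    using cont_p cont_Sig by (auto intro!: continuous_intros)
  ultimately have "(\<sigma> \<theta>)\<^sup>2 - (p \<theta>)\<^sup>2 \<ge> 0"
    using p_less by (rule_tac continuous_ge_on_closure[of "{0<..<pi}"]) (auto intro: less_imp_le)
  then show ?thesis by simp
qed

lemma f_nonneg: "\<theta> \<in> {0..pi} \<Longrightarrow> f \<theta> \<ge> 0"
  using f_pos f_poles by (cases "\<theta> = 0 \<or> \<theta> = pi") (auto intro: less_imp_le)

lemma dth_H: "\<theta> \<in> {0..pi} \<Longrightarrow> dth (H r\<^sub>0) \<theta> = 2 * f \<theta> * p \<theta>"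
  by (rule dth_square[OF f_deriv H_eq])

lemma dth_dth_H:
  assumes "\<theta> \<in> {0..pi}" shows "dth (dth (H r\<^sub>0)) \<theta> = 2 * (p \<theta>)\<^sup>2 + 2 * f \<theta> * p2 \<theta>"
proof (rule dth_eqI[OF _ assms])
  have "((\<lambda>\<theta>. 2 * f \<theta> * p \<theta>) has_real_derivative 2 * (p \<theta>)\<^sup>2 + 2 * f \<theta> * p2 \<theta>) (at \<theta> within {0..pi})"
    using f_deriv[OF assms] p_deriv[OF assms]
    by (auto intro!: derivative_eq_intros simp: power2_eq_square)
  then show "(dth (H r\<^sub>0) has_real_derivative 2 * (p \<theta>)\<^sup>2 + 2 * f \<theta> * p2 \<theta>) (at \<theta> within {0..pi})"
    by (rule has_real_derivative_eq_on[OF _ assms]) (use dth_H in auto)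
qed

text \<open>The energy density minus the \<theta>-derivative of
  \<open>f * arccos (p / sqrt l)\<close>. No quotient by \<open>\<beta>\<close> or
  \<open>sqrt (l - p\<^sup>2)\<close> is left, so it is continuous up to the poles.\<close>

definition reduced_density :: "(real \<Rightarrow> real) \<Rightarrow> (real \<Rightarrow> real) \<Rightarrow> real \<Rightarrow> real" where
  "reduced_density x y \<theta> =
    (let l = (y \<theta>)\<^sup>2 + (\<sigma> \<theta>)\<^sup>2; \<alpha> = sqrt ((x \<theta>)\<^sup>2 * (\<sigma> \<theta>)\<^sup>2 + (\<rho> \<theta>)\<^sup>2 * l)
     in - \<alpha> * M \<theta> / (2 * (\<rho> \<theta>)\<^sup>2 * (\<sigma> \<theta>)\<^sup>2)
        + (sqrt (l - (p \<theta>)\<^sup>2) - p \<theta> * arccos (p \<theta> / sqrt l))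
        + f \<theta> * (dth x \<theta> * y \<theta> - dth \<rho> \<theta> * x \<theta> * y \<theta> / \<rho> \<theta>
            + x \<theta> * (y \<theta>) ^ 3 * dth \<sigma> \<theta> / (l * \<sigma> \<theta>) - x \<theta> * (y \<theta>)\<^sup>2 * dth y \<theta> / l) / \<alpha>)"

lemma l_pos: "\<theta> \<in> {0..pi} \<Longrightarrow> z\<^sup>2 + (\<sigma> \<theta>)\<^sup>2 > 0"
  using Sig_pos[of \<theta>] by (simp add: add_nonneg_pos)

lemma arccos_argument_bounds:
  assumes "\<theta> \<in> {0..pi}" shows "\<bar>p \<theta> / sqrt (z\<^sup>2 + (\<sigma> \<theta>)\<^sup>2)\<bar> \<le> 1"
proof -
  have "(p \<theta>)\<^sup>2 \<le> z\<^sup>2 + (\<sigma> \<theta>)\<^sup>2" using p_le[OF assms] by (simp add: add_increasing)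
  then have "\<bar>p \<theta>\<bar> \<le> sqrt (z\<^sup>2 + (\<sigma> \<theta>)\<^sup>2)" by (simp add: real_le_rsqrt)
  then show ?thesis using l_pos[OF assms, of z] by (simp add: divide_le_eq)
qed

lemma \<alpha>_pos: "\<theta> \<in> {0..pi} \<Longrightarrow> x\<^sup>2 * (\<sigma> \<theta>)\<^sup>2 + (\<rho> \<theta>)\<^sup>2 * (z\<^sup>2 + (\<sigma> \<theta>)\<^sup>2) > 0"
  using l_pos[of \<theta> z] R_pos[of \<theta>] by (simp add: add_nonneg_pos)

lemma nonzero:
  assumes "\<theta> \<in> {0..pi}"
  shows "sqrt (z\<^sup>2 + (\<sigma> \<theta>)\<^sup>2) \<noteq> 0" "z\<^sup>2 + (\<sigma> \<theta>)\<^sup>2 \<noteq> 0" "\<rho> \<theta> \<noteq> 0" "\<sigma> \<theta> \<noteq> 0"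
    "(z\<^sup>2 + (\<sigma> \<theta>)\<^sup>2) * \<sigma> \<theta> \<noteq> 0" "2 * (\<rho> \<theta>)\<^sup>2 * (\<sigma> \<theta>)\<^sup>2 \<noteq> 0"
    "sqrt (x\<^sup>2 * (\<sigma> \<theta>)\<^sup>2 + (\<rho> \<theta>)\<^sup>2 * (z\<^sup>2 + (\<sigma> \<theta>)\<^sup>2)) \<noteq> 0"
  using l_pos[OF assms, of z] \<alpha>_pos[OF assms, of x z] R_pos[OF assms] Sig_pos[OF assms] by auto

lemma arccos_argument_in:
  assumes "\<theta> \<in> {0..pi}"
  shows "-1 \<le> p \<theta> / sqrt (z\<^sup>2 + (\<sigma> \<theta>)\<^sup>2) \<and> p \<theta> / sqrt (z\<^sup>2 + (\<sigma> \<theta>)\<^sup>2) \<le> 1"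
  using arccos_argument_bounds[OF assms, of z] by linarith

lemma continuous_reduced_density:
  assumes "continuous_on {0..pi} x" "continuous_on {0..pi} y"
    "continuous_on {0..pi} (dth x)" "continuous_on {0..pi} (dth y)"
  shows "continuous_on {0..pi} (reduced_density x y)"
  unfolding reduced_density_def Let_def
  by (intro continuous_intros assms cont_f cont_p cont_R cont_Sig cont_M cont_dR cont_dSig
      ballI nonzero arccos_argument_in)

text \<open>Product rule. The summand with prefactor \<open>f\<close> is the singular part isolated
  in \<open>density_identity\<close>; the other one reappears with a minus sign in
  \<open>reduced_density\<close>.\<close>

lemma arccos_flux_deriv:
  assumes \<theta>: "\<theta> \<in> {0<..<pi}" and y: "(y has_real_derivative y1) (at \<theta>)"
    and l: "l = (y \<theta>)\<^sup>2 + (\<sigma> \<theta>)\<^sup>2" and W: "W = sqrt (l - (p \<theta>)\<^sup>2)"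
  shows "((\<lambda>\<theta>. f \<theta> * arccos (p \<theta> / sqrt ((y \<theta>)\<^sup>2 + (\<sigma> \<theta>)\<^sup>2))) has_real_derivative
    p \<theta> * arccos (p \<theta> / sqrt l)
    + f \<theta> * (p \<theta> * (y \<theta> * y1 + \<sigma> \<theta> * dth \<sigma> \<theta>) / (l * W) - p2 \<theta> / W)) (at \<theta>)"
proof -
  note I = pi_interior[OF \<theta>]
  have l0: "l > 0" "(p \<theta>)\<^sup>2 < l" using l_pos[OF I(2)] p_less[OF \<theta>] l by (auto intro: add_strict_increasing2)
  have W0: "W > 0" "W\<^sup>2 = l - (p \<theta>)\<^sup>2" using l0 W by auto
  have "\<bar>p \<theta>\<bar> < sqrt l" using l0 by (simp add: real_less_rsqrt)
  then have pl: "-1 < p \<theta> / sqrt l" "p \<theta> / sqrt l < 1" using l0 by (auto simp: divide_simps abs_less_iff)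
  have "1 - (p \<theta> / sqrt l)\<^sup>2 = (W / sqrt l)\<^sup>2"
    using l0 W0 by (simp add: power_divide field_simps)
  then have sq: "sqrt (1 - (p \<theta> / sqrt l)\<^sup>2) = W / sqrt l" using W0 l0 by simp
  have dp: "(p has_real_derivative p2 \<theta>) (at \<theta>)" and df: "(f has_real_derivative p \<theta>) (at \<theta>)"
    and ds: "(\<sigma> has_real_derivative dth \<sigma> \<theta>) (at \<theta>)"
    using p_deriv[OF I(2)] f_deriv[OF I(2)] Sig_deriv[OF I(2)] unfolding I(1) by auto
  have dl: "((\<lambda>\<theta>. sqrt ((y \<theta>)\<^sup>2 + (\<sigma> \<theta>)\<^sup>2)) has_real_derivative (y \<theta> * y1 + \<sigma> \<theta> * dth \<sigma> \<theta>) / sqrt l) (at \<theta>)"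
    by (rule derivative_eq_intros y ds refl | use l0 in \<open>simp add: l[symmetric] divide_simps\<close>)+
  have dq: "((\<lambda>\<theta>. p \<theta> / sqrt ((y \<theta>)\<^sup>2 + (\<sigma> \<theta>)\<^sup>2)) has_real_derivative
      p2 \<theta> / sqrt l - p \<theta> * (y \<theta> * y1 + \<sigma> \<theta> * dth \<sigma> \<theta>) / (l * sqrt l)) (at \<theta>)"
    by (rule derivative_eq_intros dp dl refl | use l0 in \<open>simp add: l[symmetric] divide_simps\<close>)+
  have da: "((\<lambda>\<theta>. arccos (p \<theta> / sqrt ((y \<theta>)\<^sup>2 + (\<sigma> \<theta>)\<^sup>2))) has_real_derivative
      inverse (- sqrt (1 - (p \<theta> / sqrt l)\<^sup>2)) *
        (p2 \<theta> / sqrt l - p \<theta> * (y \<theta> * y1 + \<sigma> \<theta> * dth \<sigma> \<theta>) / (l * sqrt l))) (at \<theta>)"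
    using DERIV_chain2[OF DERIV_arccos[OF pl, unfolded l] dq] unfolding l .
  have "inverse (- sqrt (1 - (p \<theta> / sqrt l)\<^sup>2)) *
        (p2 \<theta> / sqrt l - p \<theta> * (y \<theta> * y1 + \<sigma> \<theta> * dth \<sigma> \<theta>) / (l * sqrt l))
      = p \<theta> * (y \<theta> * y1 + \<sigma> \<theta> * dth \<sigma> \<theta>) / (l * W) - p2 \<theta> / W"
    unfolding sq using l0 W0(1) by (simp add: field_simps)
  then show ?thesis using DERIV_mult[OF df da] unfolding l by (simp add: mult.commute)
qed

text \<open>The two densities differ by the derivative of the flux
  \<open>f * arccos (p / sqrt l)\<close>, and \<open>f\<close> vanishes at both poles, so no
  boundary term survives.\<close>

lemma integral_cnt_density:
  assumes x: "smooth_on {0..pi} x" and y: "smooth_on {0..pi} y"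
  shows "integral {0..pi} (cnt_density H R Sig r\<^sub>0 x y) = integral {0..pi} (reduced_density x y)"
proof -
  note dy = smooth_on_Icc_has_derivative[OF y] and dx = smooth_on_Icc_has_derivative[OF x]
  have cx: "continuous_on {0..pi} x" and cy: "continuous_on {0..pi} y"
    by (rule DERIV_continuous_on, erule dx dy)+
  let ?\<Phi> = "\<lambda>\<theta>. f \<theta> * arccos (p \<theta> / sqrt ((y \<theta>)\<^sup>2 + (\<sigma> \<theta>)\<^sup>2))"
  have "((\<lambda>\<theta>. cnt_density H R Sig r\<^sub>0 x y \<theta> - reduced_density x y \<theta>) has_integral (?\<Phi> pi - ?\<Phi> 0)) {0..pi}"
  \<comment> \<open>Continuity on the closed interval and differentiability inside suffice. At the
    poles the density is a quotient by 0, and the flux need not be differentiable.\<close>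
  proof (rule fundamental_theorem_of_calculus_interior)
    show "continuous_on {0..pi} ?\<Phi>"
      by (intro continuous_intros cont_f cont_p cont_Sig cy ballI nonzero arccos_argument_in)
  next
    fix \<theta> assume \<theta>: "\<theta> \<in> {0<..<pi}"
    note I = pi_interior[OF \<theta>]
    define l where "l = (y \<theta>)\<^sup>2 + (\<sigma> \<theta>)\<^sup>2"
    define W where "W = sqrt (l - (p \<theta>)\<^sup>2)"
    have "(p \<theta>)\<^sup>2 < l" using p_less[OF \<theta>] unfolding l_def by (auto intro: add_strict_increasing2)
    note D = density_identity[OF f_pos[OF \<theta>] R_pos[OF I(2)] Sig_pos[OF I(2)] this l_def refl W_def refl,
        of "x \<theta>" "M \<theta>" "p2 \<theta>" "dth \<rho> \<theta>" "dth \<sigma> \<theta>" "dth x \<theta>" "dth y \<theta>"]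
    have "cnt_density H R Sig r\<^sub>0 x y \<theta> - reduced_density x y \<theta> = p \<theta> * arccos (p \<theta> / sqrt l)
      + f \<theta> * (p \<theta> * (y \<theta> * dth y \<theta> + \<sigma> \<theta> * dth \<sigma> \<theta>) / (l * W) - p2 \<theta> / W)"
      unfolding cnt_density_def Let_def H_eq[OF I(2)] dth_H[OF I(2)] dth_dth_H[OF I(2)] M_eq[OF \<theta>]
        l_def[symmetric] D
      unfolding reduced_density_def Let_def l_def[symmetric] W_def[symmetric] by simp
    then show "(?\<Phi> has_vector_derivative cnt_density H R Sig r\<^sub>0 x y \<theta> - reduced_density x y \<theta>) (at \<theta>)"
      using arccos_flux_deriv[OF \<theta> dy[OF I(2), unfolded I(1)] l_def W_def]
      by (simp add: has_real_derivative_iff_has_vector_derivative)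
  qed simp
  then have "((\<lambda>\<theta>. cnt_density H R Sig r\<^sub>0 x y \<theta> - reduced_density x y \<theta>) has_integral 0) {0..pi}"
    by (simp add: f_poles)
  moreover have "reduced_density x y integrable_on {0..pi}"
    using smooth_on_Icc_continuous_dth x y cx cy
    by (intro integrable_continuous_interval continuous_reduced_density) auto
  \<comment> \<open>Adding the continuous reduced density back shows at the same time that the
    original density is integrable, which is not clear from its formula.\<close>
  ultimately have "((\<lambda>\<theta>. (cnt_density H R Sig r\<^sub>0 x y \<theta> - reduced_density x y \<theta>) + reduced_density x y \<theta>)
      has_integral (0 + integral {0..pi} (reduced_density x y))) {0..pi}"
    by (intro has_integral_add) (auto intro: integrable_integral)
  then show ?thesis by (simp add: integral_unique)
qed

section \<open>Differentiation under the integral and the second variation\<close>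

definition variation_density :: "(real \<Rightarrow> real) \<Rightarrow> (real \<Rightarrow> real) \<Rightarrow> real \<Rightarrow> real \<Rightarrow> real" where
  "variation_density \<xi> \<zeta> \<epsilon> \<theta> =
    (let a = (\<xi> \<theta>)\<^sup>2 * (\<sigma> \<theta>)\<^sup>2 + (\<rho> \<theta>)\<^sup>2 * (\<zeta> \<theta>)\<^sup>2;
         c = dth \<xi> \<theta> * \<zeta> \<theta> - dth \<rho> \<theta> * \<xi> \<theta> * \<zeta> \<theta> / \<rho> \<theta>;
         c' = \<xi> \<theta> * (\<zeta> \<theta>) ^ 3 * dth \<sigma> \<theta> / \<sigma> \<theta> - \<xi> \<theta> * (\<zeta> \<theta>)\<^sup>2 * dth \<zeta> \<theta>;
         l = \<epsilon>\<^sup>2 * (\<zeta> \<theta>)\<^sup>2 + (\<sigma> \<theta>)\<^sup>2; \<alpha> = sqrt (\<epsilon>\<^sup>2 * a + (\<rho> \<theta>)\<^sup>2 * (\<sigma> \<theta>)\<^sup>2)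
     in - (M \<theta> * a / (2 * (\<rho> \<theta>)\<^sup>2 * (\<sigma> \<theta>)\<^sup>2 * \<alpha>))
        + (\<zeta> \<theta>)\<^sup>2 * sqrt (l - (p \<theta>)\<^sup>2) / l
        + f \<theta> * ((2 * c + 4 * \<epsilon>\<^sup>2 * c' / l - 2 * \<epsilon> ^ 4 * c' * (\<zeta> \<theta>)\<^sup>2 / l\<^sup>2) / \<alpha>
                 - (\<epsilon>\<^sup>2 * c + \<epsilon> ^ 4 * c' / l) * a / \<alpha> ^ 3))"

text \<open>\<open>variation_density\<close> is the \<epsilon>-derivative of the reduced density
  along a ray, divided by \<epsilon>. The quotient makes sense at \<epsilon> = 0 because the reduced
  density depends on \<epsilon> only through its square.\<close>

lemma reduced_density_deriv:
  assumes adm: "admissible \<xi> \<zeta>" and \<theta>: "\<theta> \<in> {0..pi}"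
  shows "((\<lambda>\<epsilon>. reduced_density (\<lambda>\<theta>. \<epsilon> * \<xi> \<theta>) (\<lambda>\<theta>. \<epsilon> * \<zeta> \<theta>) \<theta>) has_real_derivative
    \<epsilon> * variation_density \<xi> \<zeta> \<epsilon> \<theta>) (at \<epsilon>)"
proof -
  define a where "a = (\<xi> \<theta>)\<^sup>2 * (\<sigma> \<theta>)\<^sup>2 + (\<rho> \<theta>)\<^sup>2 * (\<zeta> \<theta>)\<^sup>2"
  define b where "b = (\<rho> \<theta>)\<^sup>2 * (\<sigma> \<theta>)\<^sup>2"
  define c where "c = dth \<xi> \<theta> * \<zeta> \<theta> - dth \<rho> \<theta> * \<xi> \<theta> * \<zeta> \<theta> / \<rho> \<theta>"
  define c' where "c' = \<xi> \<theta> * (\<zeta> \<theta>) ^ 3 * dth \<sigma> \<theta> / \<sigma> \<theta> - \<xi> \<theta> * (\<zeta> \<theta>)\<^sup>2 * dth \<zeta> \<theta>"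
  define \<alpha> where "\<alpha> = sqrt (\<epsilon>\<^sup>2 * a + b)"
  have ab: "a \<ge> 0" "b > 0" unfolding a_def b_def using R_pos[OF \<theta>] Sig_pos[OF \<theta>] by auto
  have \<alpha>0: "\<epsilon>\<^sup>2 * a + b > 0" "\<alpha> > 0" unfolding \<alpha>_def using ab by (simp_all add: add_nonneg_pos)
  \<comment> \<open>At the poles the strict inequality may fail, but there \<zeta> vanishes by
    admissibility.\<close>
  have p\<zeta>: "(p \<theta>)\<^sup>2 < (\<sigma> \<theta>)\<^sup>2 \<or> \<zeta> \<theta> = 0"
    using p_less[of \<theta>] \<theta> adm by (cases "\<theta> = 0 \<or> \<theta> = pi") (auto simp: admissible_def)
  have d\<xi>: "dth (\<lambda>\<theta>. \<epsilon> * \<xi> \<theta>) \<theta> = \<epsilon> * dth \<xi> \<theta>" and d\<zeta>: "dth (\<lambda>\<theta>. \<epsilon> * \<zeta> \<theta>) \<theta> = \<epsilon> * dth \<zeta> \<theta>" for \<epsilon>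
    using adm \<theta> by (auto simp: admissible_def intro!: dth_eqI DERIV_cmult smooth_on_Icc_has_derivative)
  \<comment> \<open>Along the ray \<open>\<alpha>\<^sup>2\<close> becomes
    \<open>\<epsilon>\<^sup>2 * a + b\<close>, and the mixed terms split into an order-two
    coefficient \<open>c\<close> and an order-four coefficient \<open>c'\<close>. Three summands
    with known derivatives remain.\<close>
  have eq: "reduced_density (\<lambda>\<theta>. \<epsilon> * \<xi> \<theta>) (\<lambda>\<theta>. \<epsilon> * \<zeta> \<theta>) \<theta> =
      - (M \<theta> / (2 * b)) * sqrt (\<epsilon>\<^sup>2 * a + b)
      + (sqrt (\<epsilon>\<^sup>2 * (\<zeta> \<theta>)\<^sup>2 + (\<sigma> \<theta>)\<^sup>2 - (p \<theta>)\<^sup>2) - p \<theta> * arccos (p \<theta> / sqrt (\<epsilon>\<^sup>2 * (\<zeta> \<theta>)\<^sup>2 + (\<sigma> \<theta>)\<^sup>2)))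
      + f \<theta> * (\<epsilon>\<^sup>2 * c + \<epsilon> ^ 4 * c' / (\<epsilon>\<^sup>2 * (\<zeta> \<theta>)\<^sup>2 + (\<sigma> \<theta>)\<^sup>2)) / sqrt (\<epsilon>\<^sup>2 * a + b)" for \<epsilon>
  proof -
    define l where "l = \<epsilon>\<^sup>2 * (\<zeta> \<theta>)\<^sup>2 + (\<sigma> \<theta>)\<^sup>2"
    have 1: "(\<epsilon> * \<zeta> \<theta>)\<^sup>2 + (\<sigma> \<theta>)\<^sup>2 = l" by (simp add: l_def power_mult_distrib)
    have 2: "(\<epsilon> * \<xi> \<theta>)\<^sup>2 * (\<sigma> \<theta>)\<^sup>2 + (\<rho> \<theta>)\<^sup>2 * l = \<epsilon>\<^sup>2 * a + b"
      by (simp add: l_def a_def b_def power_mult_distrib algebra_simps)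
    have 3: "\<epsilon> * dth \<xi> \<theta> * (\<epsilon> * \<zeta> \<theta>) - dth \<rho> \<theta> * (\<epsilon> * \<xi> \<theta>) * (\<epsilon> * \<zeta> \<theta>) / \<rho> \<theta>
        + \<epsilon> * \<xi> \<theta> * (\<epsilon> * \<zeta> \<theta>) ^ 3 * dth \<sigma> \<theta> / (l * \<sigma> \<theta>)
        - \<epsilon> * \<xi> \<theta> * (\<epsilon> * \<zeta> \<theta>)\<^sup>2 * (\<epsilon> * dth \<zeta> \<theta>) / l = \<epsilon>\<^sup>2 * c + \<epsilon> ^ 4 * c' / l"
      by (simp add: c_def c'_def power_mult_distrib algebra_simps diff_divide_distrib
          power2_eq_square power3_eq_cube power4_eq_xxxx)
    show ?thesis
      unfolding reduced_density_def Let_def d\<xi> d\<zeta> 1 2 3 l_def[symmetric] by (simp add: b_def mult_ac)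
  qed
  have d\<alpha>: "((\<lambda>\<epsilon>. sqrt (\<epsilon>\<^sup>2 * a + b)) has_real_derivative \<epsilon> * a / \<alpha>) (at \<epsilon>)"
    by (rule derivative_eq_intros refl | use \<alpha>0 in \<open>simp add: \<alpha>_def divide_simps\<close>)+
  note D = DERIV_add[OF DERIV_add[OF DERIV_cmult[OF d\<alpha>, of "- (M \<theta> / (2 * b))"]
        has_real_derivative_sqrt_arccos[OF Sig_pos[OF \<theta>] p\<zeta>, of \<epsilon>]]
      has_real_derivative_cross_term[OF Sig_pos[OF \<theta>] ab(2,1) refl \<alpha>_def, of "f \<theta>" c c' "\<zeta> \<theta>"]]
  have vd: "variation_density \<xi> \<zeta> \<epsilon> \<theta> = - (M \<theta> * a / (2 * b * \<alpha>))
      + (\<zeta> \<theta>)\<^sup>2 * sqrt (\<epsilon>\<^sup>2 * (\<zeta> \<theta>)\<^sup>2 + (\<sigma> \<theta>)\<^sup>2 - (p \<theta>)\<^sup>2) / (\<epsilon>\<^sup>2 * (\<zeta> \<theta>)\<^sup>2 + (\<sigma> \<theta>)\<^sup>2)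
      + f \<theta> * ((2 * c + 4 * \<epsilon>\<^sup>2 * c' / (\<epsilon>\<^sup>2 * (\<zeta> \<theta>)\<^sup>2 + (\<sigma> \<theta>)\<^sup>2)
          - 2 * \<epsilon> ^ 4 * c' * (\<zeta> \<theta>)\<^sup>2 / (\<epsilon>\<^sup>2 * (\<zeta> \<theta>)\<^sup>2 + (\<sigma> \<theta>)\<^sup>2)\<^sup>2) / \<alpha>
        - (\<epsilon>\<^sup>2 * c + \<epsilon> ^ 4 * c' / (\<epsilon>\<^sup>2 * (\<zeta> \<theta>)\<^sup>2 + (\<sigma> \<theta>)\<^sup>2)) * a / \<alpha> ^ 3)"
    unfolding variation_density_def Let_def c_def c'_def \<alpha>_def a_def b_def by (simp add: mult.assoc)
  show ?thesis
    unfolding eq by (rule DERIV_cong[OF D]) (simp add: vd distrib_left right_diff_distrib mult.left_commute)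
qed

text \<open>Continuity holds up to the poles since \<open>sqrt (l - p\<^sup>2)\<close> occurs only
  in a numerator and all denominators are nonzero by positivity of \<open>\<rho>\<close> and
  \<open>\<sigma>\<close>. It is joint in \<epsilon> and \<theta>, as the Leibniz rule
  requires.\<close>

lemma continuous_variation_density:
  assumes adm: "admissible \<xi> \<zeta>"
  shows "continuous_on (UNIV \<times> {0..pi}) (\<lambda>(\<epsilon>, \<theta>). variation_density \<xi> \<zeta> \<epsilon> \<theta>)"
proof -
  have lift: "continuous_on (UNIV \<times> {0..pi}) (\<lambda>z. u (snd z))" if "continuous_on {0..pi} u"
    for u :: "real \<Rightarrow> real"
    by (rule continuous_on_compose2[OF that continuous_on_snd]) (auto intro: continuous_on_id)
  have s: "smooth_on {0..pi} \<xi>" "smooth_on {0..pi} \<zeta>" using adm by (auto simp: admissible_def)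
  have c: "continuous_on {0..pi} \<xi>" "continuous_on {0..pi} \<zeta>"
    by (rule DERIV_continuous_on, erule smooth_on_Icc_has_derivative[OF s(1)] smooth_on_Icc_has_derivative[OF s(2)])+
  have nz: "\<epsilon>\<^sup>2 * (\<zeta> \<theta>)\<^sup>2 + (\<sigma> \<theta>)\<^sup>2 \<noteq> 0" "(\<epsilon>\<^sup>2 * (\<zeta> \<theta>)\<^sup>2 + (\<sigma> \<theta>)\<^sup>2)\<^sup>2 \<noteq> 0"
    "sqrt (\<epsilon>\<^sup>2 * ((\<xi> \<theta>)\<^sup>2 * (\<sigma> \<theta>)\<^sup>2 + (\<rho> \<theta>)\<^sup>2 * (\<zeta> \<theta>)\<^sup>2) + (\<rho> \<theta>)\<^sup>2 * (\<sigma> \<theta>)\<^sup>2) \<noteq> 0"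
    "sqrt (\<epsilon>\<^sup>2 * ((\<xi> \<theta>)\<^sup>2 * (\<sigma> \<theta>)\<^sup>2 + (\<rho> \<theta>)\<^sup>2 * (\<zeta> \<theta>)\<^sup>2) + (\<rho> \<theta>)\<^sup>2 * (\<sigma> \<theta>)\<^sup>2) ^ 3 \<noteq> 0"
    "2 * (\<rho> \<theta>)\<^sup>2 * (\<sigma> \<theta>)\<^sup>2 *
      sqrt (\<epsilon>\<^sup>2 * ((\<xi> \<theta>)\<^sup>2 * (\<sigma> \<theta>)\<^sup>2 + (\<rho> \<theta>)\<^sup>2 * (\<zeta> \<theta>)\<^sup>2) + (\<rho> \<theta>)\<^sup>2 * (\<sigma> \<theta>)\<^sup>2) \<noteq> 0"
    "\<rho> \<theta> \<noteq> 0" "\<sigma> \<theta> \<noteq> 0"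
    if "(\<epsilon>, \<theta>) \<in> UNIV \<times> {0..pi}" for \<epsilon> \<theta>
  proof -
    have \<theta>: "\<theta> \<in> {0..pi}" using that by simp
    have "\<epsilon>\<^sup>2 * ((\<xi> \<theta>)\<^sup>2 * (\<sigma> \<theta>)\<^sup>2 + (\<rho> \<theta>)\<^sup>2 * (\<zeta> \<theta>)\<^sup>2) + (\<rho> \<theta>)\<^sup>2 * (\<sigma> \<theta>)\<^sup>2 > 0"
      "\<epsilon>\<^sup>2 * (\<zeta> \<theta>)\<^sup>2 + (\<sigma> \<theta>)\<^sup>2 > 0"
      using R_pos[OF \<theta>] Sig_pos[OF \<theta>] by (simp_all add: add_nonneg_pos)
    then show "\<epsilon>\<^sup>2 * (\<zeta> \<theta>)\<^sup>2 + (\<sigma> \<theta>)\<^sup>2 \<noteq> 0" "(\<epsilon>\<^sup>2 * (\<zeta> \<theta>)\<^sup>2 + (\<sigma> \<theta>)\<^sup>2)\<^sup>2 \<noteq> 0"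
    "sqrt (\<epsilon>\<^sup>2 * ((\<xi> \<theta>)\<^sup>2 * (\<sigma> \<theta>)\<^sup>2 + (\<rho> \<theta>)\<^sup>2 * (\<zeta> \<theta>)\<^sup>2) + (\<rho> \<theta>)\<^sup>2 * (\<sigma> \<theta>)\<^sup>2) \<noteq> 0"
    "sqrt (\<epsilon>\<^sup>2 * ((\<xi> \<theta>)\<^sup>2 * (\<sigma> \<theta>)\<^sup>2 + (\<rho> \<theta>)\<^sup>2 * (\<zeta> \<theta>)\<^sup>2) + (\<rho> \<theta>)\<^sup>2 * (\<sigma> \<theta>)\<^sup>2) ^ 3 \<noteq> 0"
    "2 * (\<rho> \<theta>)\<^sup>2 * (\<sigma> \<theta>)\<^sup>2 *
      sqrt (\<epsilon>\<^sup>2 * ((\<xi> \<theta>)\<^sup>2 * (\<sigma> \<theta>)\<^sup>2 + (\<rho> \<theta>)\<^sup>2 * (\<zeta> \<theta>)\<^sup>2) + (\<rho> \<theta>)\<^sup>2 * (\<sigma> \<theta>)\<^sup>2) \<noteq> 0"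
    "\<rho> \<theta> \<noteq> 0" "\<sigma> \<theta> \<noteq> 0"
      using R_pos[OF \<theta>] Sig_pos[OF \<theta>] by (auto dest: order_less_imp_not_eq2 simp del: real_sqrt_eq_zero_cancel_iff simp: real_sqrt_eq_0_iff)
  qed
  show ?thesis
    unfolding variation_density_def Let_def case_prod_unfold
    by (intro continuous_intros lift c cont_f cont_p cont_R cont_Sig cont_M cont_dR cont_dSig
        smooth_on_Icc_continuous_dth s ballI nz) auto
qed

text \<open>One differentiation under the integral gives \<open>\<epsilon> * I \<epsilon>\<close>
  with \<open>I\<close> continuous, and by Caratheodory such a product has derivative
  \<open>I 0\<close> at 0. Differentiating \<open>variation_density\<close> itself would bring back
  a quotient by \<open>sqrt (l - p\<^sup>2)\<close>, which can be 0 at the poles.\<close>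

lemma second_variation:
  assumes adm: "admissible \<xi> \<zeta>"
  defines "I \<equiv> \<lambda>\<epsilon>. integral {0..pi} (variation_density \<xi> \<zeta> \<epsilon>) / 4"
  shows "((\<lambda>\<epsilon>. energy H R Sig r\<^sub>0 (\<lambda>\<theta>. \<epsilon> * \<xi> \<theta>) (\<lambda>\<theta>. \<epsilon> * \<zeta> \<theta>)) has_real_derivative \<epsilon> * I \<epsilon>) (at \<epsilon>)"
    and "((\<lambda>\<epsilon>. \<epsilon> * I \<epsilon>) has_real_derivative I 0) (at 0)"
proof -
  have s: "smooth_on {0..pi} \<xi>" "smooth_on {0..pi} \<zeta>" using adm by (auto simp: admissible_def)
  note sm = smooth_on_Icc_cmult
  have E: "energy H R Sig r\<^sub>0 (\<lambda>\<theta>. \<epsilon> * \<xi> \<theta>) (\<lambda>\<theta>. \<epsilon> * \<zeta> \<theta>) =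
      integral (cbox 0 pi) (reduced_density (\<lambda>\<theta>. \<epsilon> * \<xi> \<theta>) (\<lambda>\<theta>. \<epsilon> * \<zeta> \<theta>)) / 4" for \<epsilon>
    using integral_cnt_density[OF sm[OF s(1)] sm[OF s(2)]] by (simp add: energy_def)
  have int: "reduced_density (\<lambda>\<theta>. \<epsilon> * \<xi> \<theta>) (\<lambda>\<theta>. \<epsilon> * \<zeta> \<theta>) integrable_on cbox 0 pi" for \<epsilon>
  proof -
    have "continuous_on {0..pi} (\<lambda>\<theta>. \<epsilon> * \<xi> \<theta>)" "continuous_on {0..pi} (\<lambda>\<theta>. \<epsilon> * \<zeta> \<theta>)"
      by (rule DERIV_continuous_on,
          erule smooth_on_Icc_has_derivative[OF sm[OF s(1)]] smooth_on_Icc_has_derivative[OF sm[OF s(2)]])+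
    then show ?thesis
      unfolding box_real using sm[OF s(1)] sm[OF s(2)]
      by (intro integrable_continuous_interval continuous_reduced_density smooth_on_Icc_continuous_dth)
  qed
  have cont: "continuous_on (UNIV \<times> cbox 0 pi) (\<lambda>(\<epsilon>, \<theta>). variation_density \<xi> \<zeta> \<epsilon> \<theta>)"
    using continuous_variation_density[OF adm] by simp
  have "((\<lambda>\<epsilon>. integral (cbox 0 pi) (reduced_density (\<lambda>\<theta>. \<epsilon> * \<xi> \<theta>) (\<lambda>\<theta>. \<epsilon> * \<zeta> \<theta>)))
      has_field_derivative integral (cbox 0 pi) (\<lambda>\<theta>. \<epsilon> * variation_density \<xi> \<zeta> \<epsilon> \<theta>)) (at \<epsilon> within UNIV)"
  proof (rule leibniz_rule_field_derivative)
    show "continuous_on (UNIV \<times> cbox 0 pi) (\<lambda>(\<epsilon>, \<theta>). \<epsilon> * variation_density \<xi> \<zeta> \<epsilon> \<theta>)"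
      using cont unfolding case_prod_unfold by (intro continuous_intros)
  qed (use reduced_density_deriv[OF adm] int in auto)
  from DERIV_cdivide[OF this, of 4]
  show "((\<lambda>\<epsilon>. energy H R Sig r\<^sub>0 (\<lambda>\<theta>. \<epsilon> * \<xi> \<theta>) (\<lambda>\<theta>. \<epsilon> * \<zeta> \<theta>)) has_real_derivative \<epsilon> * I \<epsilon>) (at \<epsilon>)"
    unfolding E by (simp add: I_def)
  have "continuous_on UNIV I"
    unfolding I_def using integral_continuous_on_param[OF cont] by (auto intro!: continuous_intros)
  then have "isCont I 0" by (simp add: continuous_on_eq_continuous_at)
  then show "((\<lambda>\<epsilon>. \<epsilon> * I \<epsilon>) has_real_derivative I 0) (at 0)"
    unfolding CARAT_DERIV by (intro exI[of _ I]) auto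
qed

lemma has_second_variation:
  assumes "admissible \<xi> \<zeta>"
  shows "has_second_variation_at_zero (energy H R Sig r\<^sub>0) \<xi> \<zeta>
    (integral {0..pi} (variation_density \<xi> \<zeta> 0) / 4)"
  unfolding has_second_variation_at_zero_def
  using second_variation[OF assms]
  by (intro exI[of _ "\<lambda>\<epsilon>. \<epsilon> * (integral {0..pi} (variation_density \<xi> \<zeta> \<epsilon>) / 4)"]) auto

section \<open>Criticality and the signs of the second variation\<close>

lemma critical_at_zero_energy: "critical_at_zero (energy H R Sig r\<^sub>0)"
  unfolding critical_at_zero_def using second_variation(1)[of _ _ 0] by simp

text \<open>The integral of this quadratic form is four times the second variation. Its first term
  is nonpositive where \<open>M\<close> is positive, the second is nonnegative, and only the third
  contains a derivative of the variation, so it alone grows with the frequency.\<close>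

lemma variation_density_zero:
  assumes \<theta>: "\<theta> \<in> {0..pi}"
  shows "variation_density \<xi> \<zeta> 0 \<theta> =
    - (M \<theta> * ((\<xi> \<theta>)\<^sup>2 * (\<sigma> \<theta>)\<^sup>2 + (\<rho> \<theta>)\<^sup>2 * (\<zeta> \<theta>)\<^sup>2) / (2 * (\<rho> \<theta>) ^ 3 * (\<sigma> \<theta>) ^ 3))
    + (\<zeta> \<theta>)\<^sup>2 * sqrt ((\<sigma> \<theta>)\<^sup>2 - (p \<theta>)\<^sup>2) / (\<sigma> \<theta>)\<^sup>2
    + 2 * f \<theta> / (\<rho> \<theta> * \<sigma> \<theta>) * (dth \<xi> \<theta> * \<zeta> \<theta> - dth \<rho> \<theta> * \<xi> \<theta> * \<zeta> \<theta> / \<rho> \<theta>)"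
proof -
  have "sqrt ((\<rho> \<theta>)\<^sup>2 * (\<sigma> \<theta>)\<^sup>2) = \<rho> \<theta> * \<sigma> \<theta>"
    using R_pos[OF \<theta>] Sig_pos[OF \<theta>] by (simp add: real_sqrt_mult)
  then show ?thesis
    unfolding variation_density_def Let_def
    by (simp add: power2_eq_square power3_eq_cube mult_ac)
qed

lemma continuous_variation_density_zero:
  assumes "admissible \<xi> \<zeta>"
  shows "continuous_on {0..pi} (variation_density \<xi> \<zeta> 0)"
proof -
  have "continuous_on {0..pi} ((\<lambda>(\<epsilon>, \<theta>). variation_density \<xi> \<zeta> \<epsilon> \<theta>) \<circ> Pair 0)"
    by (rule continuous_on_compose)
      (auto intro!: continuous_intros continuous_on_subset[OF continuous_variation_density[OF assms]])
  then show ?thesis by (simp add: o_def)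
qed

lemma admissible_const: "admissible (\<lambda>_. 1) (\<lambda>_. 0)"
proof -
  have "smooth_on {0..pi} (\<lambda>_. c::real)" for c
    using smooth_on_Icc_trig[of 0 0 0 c] by simp
  then show ?thesis by (simp add: admissible_def dth_eqI)
qed

text \<open>An integer frequency makes the sine vanish at both poles, which gives all four boundary
  conditions. The minus sign turns \<open>dth \<xi> \<theta> * \<zeta> \<theta>\<close> into the
  nonnegative \<open>n * (sin (n * \<theta>))\<^sup>2\<close>.\<close>

lemma admissible_trig: "admissible (\<lambda>\<theta>. cos (real n * \<theta>)) (\<lambda>\<theta>. - sin (real n * \<theta>))"
proof -
  have "dth (\<lambda>\<theta>. cos (real n * \<theta>)) \<theta> = - real n * sin (real n * \<theta>)" if "\<theta> \<in> {0..pi}" for \<theta>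
    by (rule dth_eqI[OF _ that]) (auto intro!: derivative_eq_intros)
  then show ?thesis
    using smooth_on_Icc_trig[of 1 n 0 0] smooth_on_Icc_trig[of 0 n "-1" 0]
    by (simp add: admissible_def)
qed

text \<open>With \<zeta> = 0 and \<xi> constant only the term with \<open>M\<close>
  survives.\<close>

lemma negative_variation:
  "integral {0..pi} (variation_density (\<lambda>_. 1) (\<lambda>_. 0) 0) < 0"
proof -
  let ?v = "variation_density (\<lambda>_. 1) (\<lambda>_. 0) 0"
  have v: "?v \<theta> = - (M \<theta> / (2 * \<rho> \<theta> ^ 3 * \<sigma> \<theta>))" if "\<theta> \<in> {0..pi}" for \<theta>
    using Sig_pos[OF that] unfolding variation_density_zero[OF that]
    by (simp add: power2_eq_square power3_eq_cube)
  have c: "continuous_on {0..pi} ?v"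
    by (rule continuous_variation_density_zero[OF admissible_const])
  \<comment> \<open>Strictness is asked for only in the open interval; this matters because
    positivity of \<open>M\<close> is not given at the poles.\<close>
  have "integral {0..pi} ?v < integral {0..pi} (\<lambda>_. 0)"
  proof (rule integral_less_real)
    show "continuous_on {0..pi} ?v" by (rule c)
    have "pi / 2 \<in> {0<..<pi}" by simp
    then show "{0<..<pi} \<noteq> {}" by blast
    show "?v \<theta> < 0" if "\<theta> \<in> {0<..<pi}" for \<theta>
      using M_pos[OF that] R_pos[OF pi_interior(2)[OF that]] Sig_pos[OF pi_interior(2)[OF that]]
      by (simp add: v[OF pi_interior(2)[OF that]])
  qed simp
  then show ?thesis by simp
qed

lemma positive_variation:
  "\<exists>n. integral {0..pi} (variation_density (\<lambda>\<theta>. cos (real n * \<theta>)) (\<lambda>\<theta>. - sin (real n * \<theta>)) 0) > 0"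
proof -
  \<comment> \<open>\<open>?q\<close> dominates the terms of uncontrolled sign, since sine and
    cosine are at most 1 in absolute value; \<open>?w\<close> is the weight of the mixed term that
    grows with \<open>n\<close>.\<close>
  let ?q = "\<lambda>\<theta>. \<bar>M \<theta> * ((\<sigma> \<theta>)\<^sup>2 + (\<rho> \<theta>)\<^sup>2) / (2 * (\<rho> \<theta>) ^ 3 * (\<sigma> \<theta>) ^ 3)\<bar>
    + \<bar>2 * f \<theta> / (\<rho> \<theta> * \<sigma> \<theta>) * (dth \<rho> \<theta> / \<rho> \<theta>)\<bar>"
  let ?w = "\<lambda>\<theta>. 2 * f \<theta> / (\<rho> \<theta> * \<sigma> \<theta>)"
  \<comment> \<open>The weight vanishes at the poles together with \<open>f\<close>, so a positive
    lower bound for it is sought on the middle half of the interval only.\<close>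
  have sub: "{pi / 4..3 * pi / 4} \<subseteq> {0<..<pi}"
    using pi_gt_zero by (auto simp del: pi_gt_zero)
  have cq: "continuous_on {0..pi} ?q" and cw: "continuous_on {0..pi} ?w"
    by (intro continuous_intros cont_f cont_R cont_Sig cont_M cont_dR; use nonzero in force)+
  obtain C where C: "\<And>\<theta>. \<theta> \<in> {0..pi} \<Longrightarrow> ?q \<theta> \<le> C"
    using continuous_attains_sup[OF compact_Icc _ cq] by (metis atLeastatMost_empty_iff pi_ge_zero)
  have "continuous_on {pi / 4..3 * pi / 4} ?w"
    by (rule continuous_on_subset[OF cw]) auto
  then obtain \<theta>m where \<theta>m: "\<theta>m \<in> {pi / 4..3 * pi / 4}"
    and min: "\<And>\<theta>. \<theta> \<in> {pi / 4..3 * pi / 4} \<Longrightarrow> ?w \<theta>m \<le> ?w \<theta>"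
    using continuous_attains_inf[OF compact_Icc, of "pi / 4" "3 * pi / 4" ?w] by fastforce
  have "\<theta>m \<in> {0<..<pi}" using \<theta>m sub by blast
  then have w0: "?w \<theta>m > 0"
    using f_pos R_pos Sig_pos pi_interior(2) by simp
  \<comment> \<open>The eventual gain is \<open>j * ?w \<theta>m * pi\<close> and the loss at most
    \<open>C * pi\<close>. Comparing with the absolute value of \<open>C\<close> also forces
    \<open>j > 0\<close>.\<close>
  obtain j :: nat where j: "real j * ?w \<theta>m > \<bar>C\<bar>" using w0 reals_Archimedean3 by blast
  \<comment> \<open>The factor 4 makes the boundary terms in the integral of the squared sine vanish
    at \<open>pi / 4\<close> and \<open>3 * pi / 4\<close>, leaving exactly half the length,
    \<open>pi / 4\<close>.\<close>
  define n where "n = 4 * j"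
  have "j > 0" using j by (cases j) auto
  let ?v = "variation_density (\<lambda>\<theta>. cos (real n * \<theta>)) (\<lambda>\<theta>. - sin (real n * \<theta>)) 0"
  \<comment> \<open>Adding \<open>C\<close> absorbs both terms of uncontrolled sign; the root term
    is nonnegative and is dropped.\<close>
  have lower: "?v \<theta> + C \<ge> real n * ?w \<theta> * (sin (real n * \<theta>))\<^sup>2" if \<theta>: "\<theta> \<in> {0..pi}" for \<theta>
  proof -
    define S where "S = sin (real n * \<theta>)"
    define T where "T = cos (real n * \<theta>)"
    have ST: "S\<^sup>2 \<le> 1" "T\<^sup>2 \<le> 1" "\<bar>T * S\<bar> \<le> 1"
      using abs_sin_le_one[of "real n * \<theta>"] abs_cos_le_one[of "real n * \<theta>"]
      by (auto simp: S_def T_def abs_square_le_1 abs_mult mult_le_one)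
    have d: "dth (\<lambda>\<theta>. cos (real n * \<theta>)) \<theta> = - real n * S"
      unfolding S_def by (rule dth_eqI[OF _ \<theta>]) (auto intro!: derivative_eq_intros)
    have v: "?v \<theta> = - (M \<theta> * (T\<^sup>2 * (\<sigma> \<theta>)\<^sup>2 + (\<rho> \<theta>)\<^sup>2 * S\<^sup>2) / (2 * (\<rho> \<theta>) ^ 3 * (\<sigma> \<theta>) ^ 3))
      + S\<^sup>2 * sqrt ((\<sigma> \<theta>)\<^sup>2 - (p \<theta>)\<^sup>2) / (\<sigma> \<theta>)\<^sup>2
      + (real n * ?w \<theta> * S\<^sup>2 + ?w \<theta> * (dth \<rho> \<theta> / \<rho> \<theta>) * (T * S))"
      unfolding variation_density_zero[OF \<theta>] d S_def[symmetric] T_def[symmetric]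
      by (simp add: power2_eq_square algebra_simps)
    have "\<bar>M \<theta> * (T\<^sup>2 * (\<sigma> \<theta>)\<^sup>2 + (\<rho> \<theta>)\<^sup>2 * S\<^sup>2) / (2 * (\<rho> \<theta>) ^ 3 * (\<sigma> \<theta>) ^ 3)\<bar>
        \<le> \<bar>M \<theta> * ((\<sigma> \<theta>)\<^sup>2 + (\<rho> \<theta>)\<^sup>2) / (2 * (\<rho> \<theta>) ^ 3 * (\<sigma> \<theta>) ^ 3)\<bar>"
    proof -
      have "0 \<le> T\<^sup>2 * (\<sigma> \<theta>)\<^sup>2 + (\<rho> \<theta>)\<^sup>2 * S\<^sup>2" by simp
      moreover have "T\<^sup>2 * (\<sigma> \<theta>)\<^sup>2 + (\<rho> \<theta>)\<^sup>2 * S\<^sup>2 \<le> (\<sigma> \<theta>)\<^sup>2 + (\<rho> \<theta>)\<^sup>2"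
        using ST by (intro add_mono mult_left_le_one_le mult_left_le) auto
      ultimately show ?thesis
        unfolding abs_divide abs_mult[of "M \<theta>"] by (intro divide_right_mono mult_left_mono) auto
    qed
    moreover have "\<bar>?w \<theta> * (dth \<rho> \<theta> / \<rho> \<theta>) * (T * S)\<bar> \<le> \<bar>?w \<theta> * (dth \<rho> \<theta> / \<rho> \<theta>)\<bar>"
      unfolding abs_mult[of _ "T * S"] using ST by (intro mult_left_le) auto
    moreover have "S\<^sup>2 * sqrt ((\<sigma> \<theta>)\<^sup>2 - (p \<theta>)\<^sup>2) / (\<sigma> \<theta>)\<^sup>2 \<ge> 0"
      using p_le[OF \<theta>] by simp
    ultimately show ?thesis
      unfolding v S_def[symmetric] using C[OF \<theta>] by linarith
  qed
  have cv: "continuous_on {0..pi} (\<lambda>\<theta>. ?v \<theta> + C)"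
    by (intro continuous_intros continuous_variation_density_zero admissible_trig)
  have sin: "((\<lambda>\<theta>. real n * ?w \<theta>m * (sin (real n * \<theta>))\<^sup>2) has_integral real n * ?w \<theta>m * (pi / 4)) {pi / 4..3 * pi / 4}"
  proof -
    have e: "2 * real n * (3 * pi / 4) = real (6 * j) * pi" "2 * real n * (pi / 4) = real (2 * j) * pi"
      by (simp_all add: n_def)
    show ?thesis
      using has_integral_sin_squared[of "real n" "pi / 4" "3 * pi / 4"] \<open>j > 0\<close>
      unfolding e sin_npi by (intro has_integral_mult_right) (simp add: n_def)
  qed
  have "real n * ?w \<theta>m * (pi / 4) \<le> integral {pi / 4..3 * pi / 4} (\<lambda>\<theta>. ?v \<theta> + C)"
  proof (rule has_integral_le[OF sin])
    show "((\<lambda>\<theta>. ?v \<theta> + C) has_integral integral {pi / 4..3 * pi / 4} (\<lambda>\<theta>. ?v \<theta> + C)) {pi / 4..3 * pi / 4}"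
      by (intro integrable_integral integrable_continuous_interval continuous_on_subset[OF cv]) auto
    fix \<theta> assume \<theta>: "\<theta> \<in> {pi / 4..3 * pi / 4}"
    have "real n * ?w \<theta>m * (sin (real n * \<theta>))\<^sup>2 \<le> real n * ?w \<theta> * (sin (real n * \<theta>))\<^sup>2"
      using min[OF \<theta>] by (intro mult_right_mono mult_left_mono) auto
    also have "\<dots> \<le> ?v \<theta> + C" by (rule lower) (use \<theta> sub in auto)
    finally show "real n * ?w \<theta>m * (sin (real n * \<theta>))\<^sup>2 \<le> ?v \<theta> + C" .
  qed
  \<comment> \<open>By \<open>lower\<close> and \<open>f_nonneg\<close> the integrand is nonnegative
    near the poles too, so enlarging the domain cannot decrease the integral.\<close>
  also have "\<dots> \<le> integral {0..pi} (\<lambda>\<theta>. ?v \<theta> + C)"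
  proof (rule integral_subset_le)
    show "\<forall>\<theta>\<in>{0..pi}. 0 \<le> ?v \<theta> + C"
    proof
      fix \<theta> assume \<theta>: "\<theta> \<in> {0..pi}"
      have "0 \<le> real n * ?w \<theta> * (sin (real n * \<theta>))\<^sup>2"
        using f_nonneg[OF \<theta>] R_pos[OF \<theta>] Sig_pos[OF \<theta>] by simp
      then show "0 \<le> ?v \<theta> + C" using lower[OF \<theta>] by (rule order_trans)
    qed
  qed (auto intro!: integrable_continuous_interval continuous_on_subset[OF cv])
  also have "\<dots> = integral {0..pi} ?v + C * pi"
    using continuous_variation_density_zero[OF admissible_trig]
    by (subst integral_add) (auto intro!: integrable_continuous_interval)
  finally have "real n * ?w \<theta>m * (pi / 4) - C * pi \<le> integral {0..pi} ?v" by simp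
  moreover have "real n * ?w \<theta>m * (pi / 4) - C * pi = (real j * ?w \<theta>m - C) * pi"
    by (simp add: n_def algebra_simps)
  moreover have "(real j * ?w \<theta>m - C) * pi > 0" using j by (intro mult_pos_pos) auto
  ultimately show ?thesis by (intro exI[of _ n]) linarith
qed

lemma saddle: "saddle_critical_at_zero (energy H R Sig r\<^sub>0)"
proof -
  obtain n where n: "integral {0..pi} (variation_density (\<lambda>\<theta>. cos (real n * \<theta>)) (\<lambda>\<theta>. - sin (real n * \<theta>)) 0) > 0"
    using positive_variation by blast
  show ?thesis
    unfolding saddle_critical_at_zero_def
    using critical_at_zero_energy has_second_variation[OF admissible_const] has_second_variation[OF admissible_trig[of n]]
      negative_variation n admissible_const admissible_trig[of n]
    by (meson divide_neg_pos divide_pos_pos zero_less_numeral)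
qed

end

section \<open>The metric along a meridian\<close>

lemma vector_4:
  "(vector [w, x, y, z] :: ('a::zero) ^ 4) $ 1 = w"
  "(vector [w, x, y, z] :: ('a::zero) ^ 4) $ 2 = x"
  "(vector [w, x, y, z] :: ('a::zero) ^ 4) $ 3 = y"
  "(vector [w, x, y, z] :: ('a::zero) ^ 4) $ 4 = z"
  unfolding vector_def by simp_all

lemma has_derivative_vec_nth:
  fixes f :: "'a::real_normed_vector \<Rightarrow> real ^ 'n"
  assumes "\<And>i. ((\<lambda>x. f x $ i) has_derivative (\<lambda>h. f' h $ i)) (at a within S)"
  shows "(f has_derivative f') (at a within S)"
proof (subst has_derivative_componentwise_within, intro ballI)
  fix b :: "real ^ 'n" assume "b \<in> Basis"
  then obtain i where "b = axis i 1" by (auto simp: Basis_vec_def)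
  then show "((\<lambda>x. f x \<bullet> b) has_derivative (\<lambda>x. f' x \<bullet> b)) (at a within S)"
    using assms[of i] by (simp add: inner_axis)
qed

definition sph_chart_deriv :: "real^4 \<Rightarrow> real^4 \<Rightarrow> real^4" where
  "sph_chart_deriv q v =
    vector [v $ 1,
      exp (q $ 2) * (sin (q $ 3) * cos (q $ 4) * v $ 2 + cos (q $ 3) * cos (q $ 4) * v $ 3
        - sin (q $ 3) * sin (q $ 4) * v $ 4),
      exp (q $ 2) * (sin (q $ 3) * sin (q $ 4) * v $ 2 + cos (q $ 3) * sin (q $ 4) * v $ 3
        + sin (q $ 3) * cos (q $ 4) * v $ 4),
      exp (q $ 2) * (cos (q $ 3) * v $ 2 - sin (q $ 3) * v $ 3)]"

lemma has_derivative_nth: "((\<lambda>q. q $ i) has_derivative (\<lambda>v. v $ i)) (at (a :: real^4))"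
  by (rule bounded_linear_imp_has_derivative) (rule bounded_linear_vec_nth)

lemma has_derivative_sph_chart: "(sph_chart has_derivative sph_chart_deriv q) (at q)"
proof (rule has_derivative_vec_nth)
  note D = has_derivative_nth[of _ q]
  have "\<forall>i. ((\<lambda>x. sph_chart x $ i) has_derivative (\<lambda>h. sph_chart_deriv q h $ i)) (at q)"
    unfolding forall_4 sph_chart_def sph_chart_deriv_def vector_4
    by (intro conjI; (rule derivative_eq_intros D refl)+; simp add: algebra_simps fun_eq_iff)
  then show "((\<lambda>x. sph_chart x $ i) has_derivative (\<lambda>h. sph_chart_deriv q h $ i)) (at q)" for i
    by blast
qed

lemma pullback_sph_chart:
  "pullback_metric sph_chart g q $ a $ b =
    (\<Sum>i\<in>UNIV. \<Sum>j\<in>UNIV. sph_chart_deriv q (axis a 1) $ i * g (sph_chart q) $ i $ j * sph_chart_deriv q (axis b 1) $ j)"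
proof -
  have "frechet_derivative sph_chart (at q) = sph_chart_deriv q"
    using frechet_derivative_at[OF has_derivative_sph_chart] by simp
  then have "pullback_metric sph_chart g q $ a $ b =
    (\<Sum>j\<in>UNIV. (\<Sum>i\<in>UNIV. sph_chart_deriv q (axis a 1) $ i * g (sph_chart q) $ i $ j) * sph_chart_deriv q (axis b 1) $ j)"
    by (simp add: pullback_metric_def matrix_matrix_mult_def transpose_def matrix_def)
  also have "\<dots> = (\<Sum>j\<in>UNIV. \<Sum>i\<in>UNIV. sph_chart_deriv q (axis a 1) $ i * g (sph_chart q) $ i $ j * sph_chart_deriv q (axis b 1) $ j)"
    by (simp add: sum_distrib_right)
  finally show ?thesis by (subst sum.swap)
qed

text \<open>The image under \<open>sph_chart\<close> of the curve t = 0, \<phi> = 0 at fixed r. The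
  formula makes sense for all real \<theta>, running around the full circle, so derivatives at the
  poles are two-sided.\<close>

definition meridian :: "real \<Rightarrow> real \<Rightarrow> real^4" where
  "meridian r \<theta> = vector [0, exp r * sin \<theta>, 0, exp r * cos \<theta>]"

lemma meridian_in_spacetime: "r \<in> J \<Longrightarrow> meridian r \<theta> \<in> spacetime J"
proof -
  have "(exp r * sin \<theta>)\<^sup>2 + (exp r * cos \<theta>)\<^sup>2 = (exp r)\<^sup>2"
    by (simp add: power_mult_distrib flip: distrib_left)
  then show "r \<in> J \<Longrightarrow> meridian r \<theta> \<in> spacetime J"
    by (simp add: meridian_def spacetime_def vector_4)
qed

lemma open_spacetime: assumes "open J" shows "open (spacetime J)"
proof -
  let ?n = "\<lambda>X::real^4. sqrt ((X $ 2)\<^sup>2 + (X $ 3)\<^sup>2 + (X $ 4)\<^sup>2)"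
  have "exp ` J = {0<..} \<inter> ln -` J"
    by (auto simp: image_iff) (metis exp_ln)
  moreover have "open ({0<..} \<inter> ln -` J :: real set)"
    by (rule continuous_open_preimage[OF _ _ assms]) (auto intro!: continuous_intros)
  ultimately have "open (exp ` J)" by simp
  moreover have "continuous_on UNIV ?n" by (intro continuous_intros)
  ultimately have "open (?n -` (exp ` J))"
    by (simp add: open_vimage)
  moreover have "?n -` (exp ` J) = spacetime J" by (auto simp: spacetime_def)
  ultimately show ?thesis by simp
qed

lemma smooth_on_has_derivative:
  assumes "open U" "smooth_on U u" "x \<in> U"
  shows "(u has_derivative frechet_derivative u (at x)) (at x)"
proof -
  have "times_diff_on (Suc 0) U u" using assms(2) by (simp only: smooth_on_def)
  then have "u differentiable (at x within U)"
    using assms(3) unfolding times_diff_on.simps by blast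
  then have "u differentiable (at x)"
    by (simp only: at_within_open[OF assms(3,1)])
  then show ?thesis by (rule frechet_derivative_works[THEN iffD1])
qed

text \<open>Peels one derivative off, so that the chain rule along a meridian can be applied again
  to directional derivatives. Openness of \<open>U\<close> lets the derivative within
  \<open>U\<close> be replaced by the full one.\<close>

lemma smooth_on_directional:
  assumes "open U" "smooth_on U u"
  shows "smooth_on U (\<lambda>x. frechet_derivative u (at x) v)"
  unfolding smooth_on_def
proof
  fix n
  have "times_diff_on (Suc n) U u" using assms(2) by (simp only: smooth_on_def)
  then have d: "times_diff_on n U (\<lambda>x. frechet_derivative u (at x within U) v)"
    unfolding times_diff_on.simps by blast
  have eq: "frechet_derivative u (at x within U) v = frechet_derivative u (at x) v" if "x \<in> U" for x
    by (simp only: at_within_open[OF that assms(1)])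
  show "times_diff_on n U (\<lambda>x. frechet_derivative u (at x) v)"
    by (rule times_diff_on_cong[THEN iffD1, OF eq d])
qed

text \<open>The chain rule value of the \<theta>-derivative of \<open>u\<close> along the meridian.
  Only the chart directions 2 and 4 occur, since the meridian lies in their plane;
  \<open>dmer_r\<close> is the radial counterpart.\<close>

definition dmer_th :: "(real^4 \<Rightarrow> real) \<Rightarrow> real \<Rightarrow> real \<Rightarrow> real" where
  "dmer_th u r \<theta> = exp r * cos \<theta> * frechet_derivative u (at (meridian r \<theta>)) (axis 2 1)
     - exp r * sin \<theta> * frechet_derivative u (at (meridian r \<theta>)) (axis 4 1)"

definition dmer_r :: "(real^4 \<Rightarrow> real) \<Rightarrow> real \<Rightarrow> real \<Rightarrow> real" where
  "dmer_r u r \<theta> = exp r * sin \<theta> * frechet_derivative u (at (meridian r \<theta>)) (axis 2 1)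
     + exp r * cos \<theta> * frechet_derivative u (at (meridian r \<theta>)) (axis 4 1)"

lemma meridian_deriv:
  assumes "open U" "smooth_on U u" "meridian r \<theta> \<in> U"
  shows "((\<lambda>\<theta>. u (meridian r \<theta>)) has_real_derivative dmer_th u r \<theta>) (at \<theta>)"
    and "((\<lambda>r. u (meridian r \<theta>)) has_real_derivative dmer_r u r \<theta>) (at r)"
proof -
  note D = smooth_on_has_derivative[OF assms]
  let ?L = "frechet_derivative u (at (meridian r \<theta>))"
  interpret L: bounded_linear ?L using D by (rule has_derivative_bounded_linear)
  have m: "meridian r \<theta> = (exp r * sin \<theta>) *\<^sub>R axis 2 1 + (exp r * cos \<theta>) *\<^sub>R axis 4 1" for r \<theta>
    by (simp add: meridian_def vec_eq_iff forall_4 vector_4 axis_def)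
  have c: "((\<lambda>\<theta>. meridian r \<theta>) has_derivative
      (\<lambda>t. (t * (exp r * cos \<theta>)) *\<^sub>R axis 2 1 + (t * - (exp r * sin \<theta>)) *\<^sub>R axis 4 1)) (at \<theta>)"
    unfolding m by (auto intro!: derivative_eq_intros simp: fun_eq_iff algebra_simps)
  have e: "(\<lambda>t. ?L ((t * (exp r * cos \<theta>)) *\<^sub>R axis 2 1 + (t * - (exp r * sin \<theta>)) *\<^sub>R axis 4 1))
      = (*) (dmer_th u r \<theta>)"
    unfolding L.add L.scaleR by (simp add: fun_eq_iff dmer_th_def algebra_simps)
  show "((\<lambda>\<theta>. u (meridian r \<theta>)) has_real_derivative dmer_th u r \<theta>) (at \<theta>)"
    unfolding has_field_derivative_def by (rule has_derivative_compose[OF c D, unfolded e])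
  have c': "((\<lambda>r. meridian r \<theta>) has_derivative
      (\<lambda>t. (t * (exp r * sin \<theta>)) *\<^sub>R axis 2 1 + (t * (exp r * cos \<theta>)) *\<^sub>R axis 4 1)) (at r)"
    unfolding m by (auto intro!: derivative_eq_intros simp: fun_eq_iff algebra_simps)
  have e': "(\<lambda>t. ?L ((t * (exp r * sin \<theta>)) *\<^sub>R axis 2 1 + (t * (exp r * cos \<theta>)) *\<^sub>R axis 4 1))
      = (*) (dmer_r u r \<theta>)"
    unfolding L.add L.scaleR by (simp add: fun_eq_iff dmer_r_def algebra_simps)
  show "((\<lambda>r. u (meridian r \<theta>)) has_real_derivative dmer_r u r \<theta>) (at r)"
    unfolding has_field_derivative_def by (rule has_derivative_compose[OF c' D, unfolded e'])
qed

section \<open>Twofold differentiability in one variable\<close>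

definition twice_differentiable_on :: "real set \<Rightarrow> (real \<Rightarrow> real) \<Rightarrow> bool" where
  "twice_differentiable_on S a \<longleftrightarrow> (\<exists>a1 a2. \<forall>x\<in>S. (a has_real_derivative a1 x) (at x within S) \<and>
     (a1 has_real_derivative a2 x) (at x within S))"

lemma twice_differentiable_on_add: assumes "twice_differentiable_on S a" "twice_differentiable_on S b" shows "twice_differentiable_on S (\<lambda>x. a x + b x)"
proof -
  from assms obtain a1 a2 b1 b2 where
    a: "\<And>x. x \<in> S \<Longrightarrow> (a has_real_derivative a1 x) (at x within S)"
      "\<And>x. x \<in> S \<Longrightarrow> (a1 has_real_derivative a2 x) (at x within S)" and
    b: "\<And>x. x \<in> S \<Longrightarrow> (b has_real_derivative b1 x) (at x within S)"
      "\<And>x. x \<in> S \<Longrightarrow> (b1 has_real_derivative b2 x) (at x within S)"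
    unfolding twice_differentiable_on_def by metis
  show ?thesis unfolding twice_differentiable_on_def
    by (intro exI[of _ "\<lambda>x. a1 x + b1 x"] exI[of _ "\<lambda>x. a2 x + b2 x"] ballI conjI DERIV_add a b)
qed

lemma twice_differentiable_on_mult: assumes "twice_differentiable_on S a" "twice_differentiable_on S b" shows "twice_differentiable_on S (\<lambda>x. a x * b x)"
proof -
  from assms obtain a1 a2 b1 b2 where
    a: "\<And>x. x \<in> S \<Longrightarrow> (a has_real_derivative a1 x) (at x within S)"
      "\<And>x. x \<in> S \<Longrightarrow> (a1 has_real_derivative a2 x) (at x within S)" and
    b: "\<And>x. x \<in> S \<Longrightarrow> (b has_real_derivative b1 x) (at x within S)"
      "\<And>x. x \<in> S \<Longrightarrow> (b1 has_real_derivative b2 x) (at x within S)"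
    unfolding twice_differentiable_on_def by metis
  show ?thesis unfolding twice_differentiable_on_def
    by (intro exI[of _ "\<lambda>x. a1 x * b x + b1 x * a x"]
      exI[of _ "\<lambda>x. (a2 x * b x + b1 x * a1 x) + (b2 x * a x + a1 x * b1 x)"] ballI conjI DERIV_add DERIV_mult a b)
qed

lemma twice_differentiable_on_sqrt: assumes "twice_differentiable_on S a" "\<And>x. x \<in> S \<Longrightarrow> a x > 0" shows "twice_differentiable_on S (\<lambda>x. sqrt (a x))"
proof -
  from assms obtain a1 a2 where
    a: "\<And>x. x \<in> S \<Longrightarrow> (a has_real_derivative a1 x) (at x within S)"
      "\<And>x. x \<in> S \<Longrightarrow> (a1 has_real_derivative a2 x) (at x within S)"
    unfolding twice_differentiable_on_def by metis
  have s: "((\<lambda>x. sqrt (a x)) has_real_derivative a1 x / (2 * sqrt (a x))) (at x within S)" if "x \<in> S" for x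
    by (rule derivative_eq_intros a[OF that] refl | use assms(2)[OF that] in \<open>simp add: field_simps\<close>)+
  show ?thesis unfolding twice_differentiable_on_def
  proof (intro exI ballI conjI)
    fix x assume x: "x \<in> S"
    show "((\<lambda>x. sqrt (a x)) has_real_derivative a1 x / (2 * sqrt (a x))) (at x within S)" by (rule s[OF x])
    show "((\<lambda>x. a1 x / (2 * sqrt (a x))) has_real_derivative
      (a2 x * (2 * sqrt (a x)) - a1 x * (2 * (a1 x / (2 * sqrt (a x))))) / (2 * sqrt (a x) * (2 * sqrt (a x)))) (at x within S)"
      by (intro DERIV_divide DERIV_cmult a s x) (use assms(2)[OF x] in auto)
  qed
qed

lemma twice_differentiable_on_const: "twice_differentiable_on S (\<lambda>_. c)"
  unfolding twice_differentiable_on_def by (intro exI[of _ "\<lambda>_. 0"]) auto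

lemma twice_differentiable_on_sin: "twice_differentiable_on S sin"
  unfolding twice_differentiable_on_def by (intro exI[of _ cos] exI[of _ "\<lambda>x. - sin x"]) (auto intro!: derivative_eq_intros)

lemma twice_differentiable_on_cos: "twice_differentiable_on S cos"
  unfolding twice_differentiable_on_def by (intro exI[of _ "\<lambda>x. - sin x"] exI[of _ "\<lambda>x. - cos x"]) (auto intro!: derivative_eq_intros)

lemma twice_differentiable_on_minus: "twice_differentiable_on S a \<Longrightarrow> twice_differentiable_on S (\<lambda>x. - a x)"
  using twice_differentiable_on_mult[OF twice_differentiable_on_const[of S "-1"], of a] by simp

lemma twice_differentiable_on_continuous: assumes "twice_differentiable_on S a" shows "continuous_on S a"
proof -
  from assms obtain a1 where "\<And>x. x \<in> S \<Longrightarrow> (a has_real_derivative a1 x) (at x within S)"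
    unfolding twice_differentiable_on_def by blast
  then show ?thesis by (rule DERIV_continuous_on)
qed

lemma twice_differentiable_on_cong: "(\<And>x. x \<in> S \<Longrightarrow> a x = b x) \<Longrightarrow> twice_differentiable_on S a \<Longrightarrow> twice_differentiable_on S b"
  unfolding twice_differentiable_on_def using has_real_derivative_eq_on[of a _ _ S b] by metis

text \<open>By uniqueness of derivatives within the interval, \<open>dth a\<close> is the first
  derivative \<open>a1\<close>, which is continuous because it is differentiable itself.\<close>

lemma twice_differentiable_on_dth:
  assumes "twice_differentiable_on {0..pi} a"
  shows "\<And>\<theta>. \<theta> \<in> {0..pi} \<Longrightarrow> (a has_real_derivative dth a \<theta>) (at \<theta> within {0..pi})"
    and "continuous_on {0..pi} (dth a)"
proof -
  from assms obtain a1 a2 where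
    a: "\<And>x. x \<in> {0..pi} \<Longrightarrow> (a has_real_derivative a1 x) (at x within {0..pi})"
      "\<And>x. x \<in> {0..pi} \<Longrightarrow> (a1 has_real_derivative a2 x) (at x within {0..pi})"
    unfolding twice_differentiable_on_def by metis
  have d: "dth a \<theta> = a1 \<theta>" if "\<theta> \<in> {0..pi}" for \<theta> by (rule dth_eqI[OF a(1)[OF that] that])
  then show "\<And>\<theta>. \<theta> \<in> {0..pi} \<Longrightarrow> (a has_real_derivative dth a \<theta>) (at \<theta> within {0..pi})" using a by metis
  have "continuous_on {0..pi} a1" by (rule DERIV_continuous_on, erule a(2))
  then show "continuous_on {0..pi} (dth a)" using d continuous_on_cong by metis
qed

text \<open>\<open>dmer_th u\<close> combines sines and cosines with directional derivatives of
  \<open>u\<close> along the meridian. These are smooth on \<open>U\<close> again, so the chain rule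
  applies a second time.\<close>

lemma twice_differentiable_on_meridian:
  assumes "open U" "smooth_on U u" "\<And>\<theta>. meridian r \<theta> \<in> U"
  shows "twice_differentiable_on S (\<lambda>\<theta>. u (meridian r \<theta>))"
proof -
  let ?D = "\<lambda>v x. frechet_derivative u (at x) v"
  have "((\<lambda>\<theta>. ?D v (meridian r \<theta>)) has_real_derivative dmer_th (?D v) r \<theta>) (at \<theta>)" for v \<theta>
    by (rule meridian_deriv[OF assms(1) smooth_on_directional[OF assms(1,2)] assms(3)])
  note d = this[THEN DERIV_mult[rotated]]
  have s: "((\<lambda>\<theta>. exp r * sin \<theta>) has_real_derivative exp r * cos \<theta>) (at \<theta>)"
    "((\<lambda>\<theta>. exp r * cos \<theta>) has_real_derivative - (exp r * sin \<theta>)) (at \<theta>)" for \<theta>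
    by (auto intro!: derivative_eq_intros)
  have "\<exists>d. (dmer_th u r has_real_derivative d) (at \<theta>)" for \<theta>
    unfolding dmer_th_def[abs_def] using DERIV_diff[OF d[OF s(2)] d[OF s(1)]] by blast
  then obtain d where d: "\<And>\<theta>. (dmer_th u r has_real_derivative d \<theta>) (at \<theta>)" by metis
  show ?thesis
    unfolding twice_differentiable_on_def
  proof (intro exI ballI conjI)
    fix \<theta>
    show "((\<lambda>\<theta>. u (meridian r \<theta>)) has_real_derivative dmer_th u r \<theta>) (at \<theta> within S)"
      by (rule has_field_derivative_at_within[OF meridian_deriv(1)[OF assms]])
    show "(dmer_th u r has_real_derivative d \<theta>) (at \<theta> within S)"
      by (rule has_field_derivative_at_within[OF d])
  qed
qed

text \<open>The directional derivatives are differentiable in \<theta>, hence continuous. This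
  serves the continuity of \<open>M\<close>, which contains radial derivatives of the metric
  components.\<close>

lemma continuous_dmer_r:
  assumes "open U" "smooth_on U u" "\<And>\<theta>. meridian r \<theta> \<in> U"
  shows "continuous_on S (dmer_r u r)"
proof -
  have "continuous_on S (\<lambda>\<theta>. frechet_derivative u (at (meridian r \<theta>)) v)" for v
  proof (rule DERIV_continuous_on)
    fix \<theta>
    show "((\<lambda>\<theta>. frechet_derivative u (at (meridian r \<theta>)) v) has_real_derivative
        dmer_th (\<lambda>x. frechet_derivative u (at x) v) r \<theta>) (at \<theta> within S)"
      by (rule has_field_derivative_at_within,
          rule meridian_deriv(1)[OF assms(1) smooth_on_directional[OF assms(1,2)] assms(3)])
  qed
  then show ?thesis unfolding dmer_r_def[abs_def] by (intro continuous_intros)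
qed

section \<open>Metric components and mean curvature in spherical coordinates\<close>

lemma sph_chart_deriv_basis:
  "sph_chart_deriv q (axis 2 1) = vector [0, exp (q $ 2) * sin (q $ 3) * cos (q $ 4),
     exp (q $ 2) * sin (q $ 3) * sin (q $ 4), exp (q $ 2) * cos (q $ 3)]"
  "sph_chart_deriv q (axis 3 1) = vector [0, exp (q $ 2) * cos (q $ 3) * cos (q $ 4),
     exp (q $ 2) * cos (q $ 3) * sin (q $ 4), - exp (q $ 2) * sin (q $ 3)]"
  "sph_chart_deriv q (axis 4 1) = vector [0, - exp (q $ 2) * sin (q $ 3) * sin (q $ 4),
     exp (q $ 2) * sin (q $ 3) * cos (q $ 4), 0]"
  by (simp_all add: sph_chart_deriv_def axis_def mult.assoc)

text \<open>The first three claims are diagonal entries of the pulled-back metric at t = \<phi> = 0.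
  The last one is regularity on the axis: the same point is reached with every \<phi>, and at \<phi>
  = pi / 2 the \<theta>-direction lies along chart direction 3.\<close>

lemma kerr_like_components:
  assumes metric: "\<And>q. q $ 2 \<in> J \<Longrightarrow> q $ 3 \<in> {0..pi} \<Longrightarrow>
      pullback_metric sph_chart g q = kerr_like_matrix F G H R Sig q"
    and r: "r \<in> J" and \<theta>: "\<theta> \<in> {0..pi}"
  defines "m \<equiv> \<lambda>i j. g (meridian r \<theta>) $ i $ j"
  shows "(R r \<theta>)\<^sup>2 = (exp r)\<^sup>2 * ((sin \<theta>)\<^sup>2 * m 2 2 + sin \<theta> * cos \<theta> * (m 2 4 + m 4 2) + (cos \<theta>)\<^sup>2 * m 4 4)"
    and "(Sig r \<theta>)\<^sup>2 = (exp r)\<^sup>2 * ((cos \<theta>)\<^sup>2 * m 2 2 + - sin \<theta> * cos \<theta> * (m 2 4 + m 4 2) + (sin \<theta>)\<^sup>2 * m 4 4)"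
    and "H r \<theta> = (exp r)\<^sup>2 * (sin \<theta>)\<^sup>2 * m 3 3"
    and "sin \<theta> = 0 \<Longrightarrow> (Sig r \<theta>)\<^sup>2 = (exp r)\<^sup>2 * m 3 3"
proof -
  let ?q = "\<lambda>\<phi>. vector [0, r, \<theta>, \<phi>] :: real^4"
  have X: "sph_chart (?q 0) = meridian r \<theta>" by (simp add: sph_chart_def meridian_def vector_4)
  have pb: "pullback_metric sph_chart g (?q \<phi>) $ a $ b = kerr_like_matrix F G H R Sig (?q \<phi>) $ a $ b" for a b \<phi>
    by (subst metric) (use r \<theta> in \<open>simp_all add: vector_4\<close>)
  note comp = pb[unfolded pullback_sph_chart kerr_like_matrix_def Let_def, symmetric]
  show "(R r \<theta>)\<^sup>2 = (exp r)\<^sup>2 * ((sin \<theta>)\<^sup>2 * m 2 2 + sin \<theta> * cos \<theta> * (m 2 4 + m 4 2) + (cos \<theta>)\<^sup>2 * m 4 4)"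
    using comp[of 0 2 2] unfolding X sph_chart_deriv_basis
    by (simp add: vector_4 sum_4 m_def power2_eq_square algebra_simps)
  show "(Sig r \<theta>)\<^sup>2 = (exp r)\<^sup>2 * ((cos \<theta>)\<^sup>2 * m 2 2 + - sin \<theta> * cos \<theta> * (m 2 4 + m 4 2) + (sin \<theta>)\<^sup>2 * m 4 4)"
    using comp[of 0 3 3] unfolding X sph_chart_deriv_basis
    by (simp add: vector_4 sum_4 m_def power2_eq_square algebra_simps)
  show "H r \<theta> = (exp r)\<^sup>2 * (sin \<theta>)\<^sup>2 * m 3 3"
    using comp[of 0 4 4] unfolding X sph_chart_deriv_basis
    by (simp add: vector_4 sum_4 m_def power2_eq_square algebra_simps)
  show "(Sig r \<theta>)\<^sup>2 = (exp r)\<^sup>2 * m 3 3" if s: "sin \<theta> = 0"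
  proof -
    have Xp: "sph_chart (?q (pi / 2)) = meridian r \<theta>"
      using s by (simp add: sph_chart_def meridian_def vector_4)
    have "(cos \<theta>)\<^sup>2 = 1" using s by (simp add: cos_squared_eq)
    then have "cos \<theta> * cos \<theta> = 1" by (simp add: power2_eq_square)
    then show ?thesis
      using comp[of "pi / 2" 3 3] s unfolding Xp sph_chart_deriv_basis
      by (simp add: vector_4 sum_4 m_def power2_eq_square)
  qed
qed

text \<open>The matrix entries (4,2) and (3,2) vanish, so the two Christoffel symbols are minus half
  the r-derivatives of \<open>H\<close> and of \<open>Sig\<^sup>2\<close>. Inside the interval
  \<open>pole_ext\<close> changes nothing.\<close>

lemma mean_curvature_interior:
  assumes \<theta>: "\<theta> \<in> {0<..<pi}"
  shows "mean_curvature F G H R Sig t r \<phi> \<theta> =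
    (deriv (\<lambda>r. H r \<theta>) r / H r \<theta> + deriv (\<lambda>r. (Sig r \<theta>)\<^sup>2) r / (Sig r \<theta>)\<^sup>2) / (2 * R r \<theta>)"
proof -
  have shift: "deriv (\<lambda>s. u (r + s)) 0 = deriv u r" for u :: "real \<Rightarrow> real"
    using deriv_shift_0[of u r] by (simp only: o_def)
  have k: "kerr_like_matrix F G H R Sig q $ 4 $ 2 = 0" "kerr_like_matrix F G H R Sig q $ 3 $ 2 = 0"
    "kerr_like_matrix F G H R Sig q $ 4 $ 4 = H (q $ 2) (q $ 3)"
    "kerr_like_matrix F G H R Sig q $ 3 $ 3 = (Sig (q $ 2) (q $ 3))\<^sup>2" for q
    by (simp_all add: kerr_like_matrix_def Let_def vector_4)
  note shift' = shift[of "\<lambda>r. H r \<theta>"] shift[of "\<lambda>r. (Sig r \<theta>)\<^sup>2"]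
  have "mean_curvature F G H R Sig t r \<phi> \<theta> =
    - (1 / H r \<theta> * (1 / R r \<theta> * (- deriv (\<lambda>r. H r \<theta>) r / 2))
       + 1 / (Sig r \<theta>)\<^sup>2 * (1 / R r \<theta> * (- deriv (\<lambda>r. (Sig r \<theta>)\<^sup>2) r / 2)))"
    using \<theta> by (simp add: mean_curvature_def pole_ext_def christoffel_first_def partial_def k vector_4 axis_def shift')
  then show ?thesis by (simp add: add_divide_distrib mult.commute)
qed

text \<open>As the metric is smooth across the axis, \<open>H\<close> is
  \<open>(sin \<theta>)\<^sup>2\<close> times a regular cofactor that is positive up to the poles.
  Hence its root \<open>f\<close> and the quotient \<open>M\<close> extend regularly to the
  poles.\<close>

lemma kerr_like_metric_imp_kerr_sphere:
  assumes metric: "kerr_like_metric J F G H R Sig"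
    and r0: "r\<^sub>0 \<in> J"
    and real_beta: "\<forall>\<theta>\<in>{0<..<pi}. 4 * H r\<^sub>0 \<theta> * (Sig r\<^sub>0 \<theta>)\<^sup>2 - (dth (H r\<^sub>0) \<theta>)\<^sup>2 > 0"
    and mean_curv_pos: "\<forall>\<theta>\<in>{0..pi}. \<forall>\<phi>. mean_curvature F G H R Sig t\<^sub>0 r\<^sub>0 \<phi> \<theta> > 0"
  shows "\<exists>f p p2 M. kerr_sphere H R Sig r\<^sub>0 f p p2 M"
proof -
  have pos: "0 < b" if "0 < a * b" "0 \<le> a" for a b :: real
    using that by (auto simp: zero_less_mult_iff)
  note metric' = metric[unfolded kerr_like_metric_def]
  have J: "open J" using metric' by (rule conjunct1)
  have RS: "R r \<theta> > 0 \<and> Sig r \<theta> > 0" if "r \<in> J" "\<theta> \<in> {0..pi}" for r \<theta>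
    using metric'[THEN conjunct2, THEN conjunct1] that by blast
  have Hpos: "H r \<theta> > 0" if "r \<in> J" "\<theta> \<in> {0<..<pi}" for r \<theta>
    using metric'[THEN conjunct2, THEN conjunct2, THEN conjunct1] that by blast
  obtain g where smooth: "\<And>i j. smooth_on (spacetime J) (\<lambda>X. g X $ i $ j)"
    and pb: "\<And>q. q $ 2 \<in> J \<Longrightarrow> q $ 3 \<in> {0..pi} \<Longrightarrow>
      pullback_metric sph_chart g q = kerr_like_matrix F G H R Sig q"
    using metric'[THEN conjunct2, THEN conjunct2, THEN conjunct2, THEN conjunct2] by blast
  note R0 = RS[OF r0, THEN conjunct1] and S0 = RS[OF r0, THEN conjunct2]
  note comp = kerr_like_components[OF pb]
  note U = open_spacetime[OF J] and mer = meridian_in_spacetime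
  define m where "m i j r \<theta> = g (meridian r \<theta>) $ i $ j" for i j r \<theta>
  define dm where "dm i j = dmer_r (\<lambda>X. g X $ i $ j) r\<^sub>0" for i j
  have m_r: "((\<lambda>r. m i j r \<theta>) has_real_derivative dm i j \<theta>) (at r\<^sub>0)" for i j \<theta>
    unfolding m_def dm_def by (rule meridian_deriv(2)[OF U smooth mer[OF r0]])
  have m_C2: "twice_differentiable_on S (m i j r\<^sub>0)" for i j S
    unfolding m_def by (rule twice_differentiable_on_meridian[OF U smooth mer[OF r0]])
  have cont_dm: "continuous_on S (dm i j)" for i j S
    unfolding dm_def by (rule continuous_dmer_r[OF U smooth mer[OF r0]])
  let ?I = "{0..pi}"
  define S where "S r \<theta> = (exp r)\<^sup>2 * ((cos \<theta>)\<^sup>2 * m 2 2 r \<theta> + - sin \<theta> * cos \<theta> * (m 2 4 r \<theta> + m 4 2 r \<theta>)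
      + (sin \<theta>)\<^sup>2 * m 4 4 r \<theta>)" for r \<theta>
  define T where "T r \<theta> = (exp r)\<^sup>2 * ((sin \<theta>)\<^sup>2 * m 2 2 r \<theta> + sin \<theta> * cos \<theta> * (m 2 4 r \<theta> + m 4 2 r \<theta>)
      + (cos \<theta>)\<^sup>2 * m 4 4 r \<theta>)" for r \<theta>
  have Sig_eq: "(Sig r \<theta>)\<^sup>2 = S r \<theta>" and R_eq: "(R r \<theta>)\<^sup>2 = T r \<theta>"
    and H_eq: "H r \<theta> = (exp r)\<^sup>2 * (sin \<theta>)\<^sup>2 * m 3 3 r \<theta>"
    if "r \<in> J" "\<theta> \<in> ?I" for r \<theta>
    using comp(1-3)[OF _ _ that] by (simp_all add: S_def T_def m_def)
  \<comment> \<open>In the interior this follows from \<open>H > 0\<close>. At the poles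
    \<open>H\<close> vanishes and carries no information; there the axis relation reduces it to
    \<open>Sig > 0\<close>.\<close>
  have m33: "m 3 3 r\<^sub>0 \<theta> > 0" if \<theta>: "\<theta> \<in> ?I" for \<theta>
  proof (cases "\<theta> \<in> {0<..<pi}")
    case True
    then have "0 < (exp r\<^sub>0)\<^sup>2 * (sin \<theta>)\<^sup>2 * m 3 3 r\<^sub>0 \<theta>" using Hpos[OF r0 True] H_eq[OF r0 \<theta>] by simp
    then show ?thesis by (rule pos) simp
  next
    case False
    with \<theta> have "sin \<theta> = 0" by (cases "\<theta> = 0") auto
    then have "(Sig r\<^sub>0 \<theta>)\<^sup>2 = (exp r\<^sub>0)\<^sup>2 * m 3 3 r\<^sub>0 \<theta>"
      using comp(4)[OF _ _ r0 \<theta>] by (simp add: m_def)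
    moreover have "(Sig r\<^sub>0 \<theta>)\<^sup>2 > 0" using S0[OF \<theta>] by simp
    ultimately have "0 < (exp r\<^sub>0)\<^sup>2 * m 3 3 r\<^sub>0 \<theta>" by simp
    then show ?thesis by (rule pos) simp
  qed
  \<comment> \<open>Only the squares of \<open>Sig\<close> and \<open>R\<close> are directly
    expressed by the metric components; positivity lets regularity pass to the roots.\<close>
  have "twice_differentiable_on ?I (S r\<^sub>0)" "twice_differentiable_on ?I (T r\<^sub>0)"
    unfolding S_def T_def power2_eq_square
    by (intro twice_differentiable_on_add twice_differentiable_on_minus twice_differentiable_on_mult twice_differentiable_on_const twice_differentiable_on_sin twice_differentiable_on_cos m_C2)+
  then have "twice_differentiable_on ?I (\<lambda>\<theta>. sqrt (S r\<^sub>0 \<theta>))" "twice_differentiable_on ?I (\<lambda>\<theta>. sqrt (T r\<^sub>0 \<theta>))"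
    using S0 R0 by (auto intro!: twice_differentiable_on_sqrt simp: Sig_eq[OF r0, symmetric] R_eq[OF r0, symmetric] less_imp_neq[symmetric])
  moreover have "sqrt (S r\<^sub>0 \<theta>) = Sig r\<^sub>0 \<theta>" "sqrt (T r\<^sub>0 \<theta>) = R r\<^sub>0 \<theta>" if "\<theta> \<in> ?I" for \<theta>
    using S0[OF that] R0[OF that] by (simp_all add: Sig_eq[OF r0 that, symmetric] R_eq[OF r0 that, symmetric])
  ultimately have SigC2: "twice_differentiable_on ?I (Sig r\<^sub>0)" and RC2: "twice_differentiable_on ?I (R r\<^sub>0)"
    using twice_differentiable_on_cong[of ?I "\<lambda>\<theta>. sqrt (S r\<^sub>0 \<theta>)" "Sig r\<^sub>0"] twice_differentiable_on_cong[of ?I "\<lambda>\<theta>. sqrt (T r\<^sub>0 \<theta>)" "R r\<^sub>0"]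
    by blast+
  \<comment> \<open>The root of \<open>H\<close> that is positive between the poles. With
    \<open>sin \<theta>\<close> taken out, the square root is applied to a positive function
    only.\<close>
  define f where "f \<theta> = exp r\<^sub>0 * sin \<theta> * sqrt (m 3 3 r\<^sub>0 \<theta>)" for \<theta>
  have "twice_differentiable_on ?I f"
    unfolding f_def by (intro twice_differentiable_on_mult twice_differentiable_on_const twice_differentiable_on_sin twice_differentiable_on_sqrt m_C2 m33)
  then obtain p p2 where
    p: "\<And>\<theta>. \<theta> \<in> ?I \<Longrightarrow> (f has_real_derivative p \<theta>) (at \<theta> within ?I)"
      "\<And>\<theta>. \<theta> \<in> ?I \<Longrightarrow> (p has_real_derivative p2 \<theta>) (at \<theta> within ?I)"
    unfolding twice_differentiable_on_def by metis
  have Hf: "H r\<^sub>0 \<theta> = (f \<theta>)\<^sup>2" if "\<theta> \<in> ?I" for \<theta>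
    using H_eq[OF r0 that] m33[OF that] by (simp add: f_def power_mult_distrib)
  have fpos: "f \<theta> > 0" if "\<theta> \<in> {0<..<pi}" for \<theta>
    using m33[OF pi_interior(2)[OF that]] that by (simp add: f_def sin_gt_zero)
  have dH: "dth (H r\<^sub>0) \<theta> = 2 * f \<theta> * p \<theta>" if \<theta>: "\<theta> \<in> ?I" for \<theta>
    by (rule dth_square[OF p(1)[OF \<theta>] Hf \<theta>])
  have p_less: "(p \<theta>)\<^sup>2 < (Sig r\<^sub>0 \<theta>)\<^sup>2" if \<theta>: "\<theta> \<in> {0<..<pi}" for \<theta>
  proof -
    \<comment> \<open>This is the assumption \<open>real_beta\<close> with \<open>H\<close> and its
      derivative expressed by \<open>f\<close> and \<open>p\<close>.\<close>
    have "0 < 4 * (f \<theta>)\<^sup>2 * ((Sig r\<^sub>0 \<theta>)\<^sup>2 - (p \<theta>)\<^sup>2)"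
      using real_beta[rule_format, OF \<theta>] Hf dH pi_interior(2)[OF \<theta>]
      by (simp add: power_mult_distrib algebra_simps)
    then have "0 < (Sig r\<^sub>0 \<theta>)\<^sup>2 - (p \<theta>)\<^sup>2" by (rule pos) simp
    then show ?thesis by simp
  qed
  \<comment> \<open>Radial derivatives by the product rule; the summands with the factor 2 come from
    differentiating \<open>(exp r)\<^sup>2\<close>.\<close>
  define dH where "dH \<theta> = (exp r\<^sub>0)\<^sup>2 * (sin \<theta>)\<^sup>2 * (2 * m 3 3 r\<^sub>0 \<theta> + dm 3 3 \<theta>)" for \<theta>
  define dS where "dS \<theta> = 2 * S r\<^sub>0 \<theta> + (exp r\<^sub>0)\<^sup>2 * ((cos \<theta>)\<^sup>2 * dm 2 2 \<theta>
      + - sin \<theta> * cos \<theta> * (dm 2 4 \<theta> + dm 4 2 \<theta>) + (sin \<theta>)\<^sup>2 * dm 4 4 \<theta>)" for \<theta>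
  have exp2: "((\<lambda>r. (exp r)\<^sup>2) has_real_derivative 2 * (exp r\<^sub>0)\<^sup>2) (at r\<^sub>0)"
    by (auto intro!: derivative_eq_intros simp: power2_eq_square)
  \<comment> \<open>The component formula holds only for r in \<open>J\<close>; since
    \<open>J\<close> is open, it determines the derivative at \<open>r\<^sub>0\<close>.\<close>
  have H_r: "((\<lambda>r. H r \<theta>) has_real_derivative dH \<theta>) (at r\<^sub>0)" if \<theta>: "\<theta> \<in> ?I" for \<theta>
  proof (rule has_field_derivative_transform_within_open[OF _ J r0])
    show "((\<lambda>r. (exp r)\<^sup>2 * (sin \<theta>)\<^sup>2 * m 3 3 r \<theta>) has_real_derivative dH \<theta>) (at r\<^sub>0)"
      by (rule DERIV_cong[OF DERIV_mult[OF DERIV_cmult_right[OF exp2] m_r]]) (simp add: dH_def algebra_simps)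
  qed (simp add: H_eq[OF _ \<theta>])
  have S_r: "((\<lambda>r. (Sig r \<theta>)\<^sup>2) has_real_derivative dS \<theta>) (at r\<^sub>0)" if \<theta>: "\<theta> \<in> ?I" for \<theta>
  proof (rule has_field_derivative_transform_within_open[OF _ J r0])
    show "((\<lambda>r. S r \<theta>) has_real_derivative dS \<theta>) (at r\<^sub>0)"
      unfolding S_def[abs_def]
      by (rule DERIV_cong[OF DERIV_mult[OF exp2 DERIV_add[OF DERIV_add[OF DERIV_cmult[OF m_r]
              DERIV_cmult[OF DERIV_add[OF m_r m_r]]] DERIV_cmult[OF m_r]]]])
        (simp add: dS_def S_def mult.commute mult.left_commute)
  qed (simp add: Sig_eq[OF _ \<theta>])
  \<comment> \<open>The r-derivative of H Sig^2 divided by \<open>f\<close>, with one factor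
    \<open>sin \<theta>\<close> already cancelled, so that it is continuous at the poles, where
    \<open>f\<close> vanishes.\<close>
  define M where "M \<theta> = exp r\<^sub>0 * sin \<theta> * (2 * m 3 3 r\<^sub>0 \<theta> + dm 3 3 \<theta>) / sqrt (m 3 3 r\<^sub>0 \<theta>) * S r\<^sub>0 \<theta>
      + f \<theta> * dS \<theta>" for \<theta>
  have fM: "dH \<theta> * (Sig r\<^sub>0 \<theta>)\<^sup>2 + H r\<^sub>0 \<theta> * dS \<theta> = f \<theta> * M \<theta>" if \<theta>: "\<theta> \<in> ?I" for \<theta>
    unfolding Hf[OF \<theta>] Sig_eq[OF r0 \<theta>] dH_def M_def using m33[OF \<theta>]
    by (simp add: f_def power2_eq_square field_simps)
  have M_eq: "deriv (\<lambda>r. H r \<theta> * (Sig r \<theta>)\<^sup>2) r\<^sub>0 = f \<theta> * M \<theta>" if \<theta>: "\<theta> \<in> ?I" for \<theta>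
    unfolding fM[OF \<theta>, symmetric]
    by (rule DERIV_imp_deriv) (use DERIV_mult[OF H_r[OF \<theta>] S_r[OF \<theta>]] in \<open>simp add: mult.commute\<close>)
  have M_pos: "M \<theta> > 0" if \<theta>: "\<theta> \<in> {0<..<pi}" for \<theta>
  proof -
    note I = pi_interior(2)[OF \<theta>]
    have h: "H r\<^sub>0 \<theta> > 0" "(Sig r\<^sub>0 \<theta>)\<^sup>2 > 0" using Hpos[OF r0 \<theta>] S0[OF I] by auto
    \<comment> \<open>The mean curvature is the logarithmic r-derivative of H Sig^2 divided by
      \<open>2 * R\<close>, so it has the sign of \<open>f * M\<close>, and \<open>f\<close> is
      positive here.\<close>
    have "0 < (dH \<theta> / H r\<^sub>0 \<theta> + dS \<theta> / (Sig r\<^sub>0 \<theta>)\<^sup>2) / (2 * R r\<^sub>0 \<theta>)"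
      using mean_curv_pos[rule_format, OF I] unfolding mean_curvature_interior[OF \<theta>]
        DERIV_imp_deriv[OF H_r[OF I]] DERIV_imp_deriv[OF S_r[OF I]] .
    then have "0 < dH \<theta> / H r\<^sub>0 \<theta> + dS \<theta> / (Sig r\<^sub>0 \<theta>)\<^sup>2" using R0[OF I] by (simp add: zero_less_divide_iff)
    also have "\<dots> = f \<theta> * M \<theta> / (H r\<^sub>0 \<theta> * (Sig r\<^sub>0 \<theta>)\<^sup>2)"
      unfolding fM[OF I, symmetric] using h by (simp add: field_simps)
    finally have "0 < 1 / (H r\<^sub>0 \<theta> * (Sig r\<^sub>0 \<theta>)\<^sup>2) * (f \<theta> * M \<theta>)" by simp
    then have "0 < f \<theta> * M \<theta>" by (rule pos) (use h in simp)
    then show ?thesis by (rule pos) (use fpos[OF \<theta>] in simp)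
  qed
  have cont_m: "continuous_on ?I (m i j r\<^sub>0)" for i j
    by (rule twice_differentiable_on_continuous[OF m_C2])
  have nz: "sqrt (m 3 3 r\<^sub>0 \<theta>) \<noteq> 0" if "\<theta> \<in> ?I" for \<theta>
    using m33[OF that] by simp
  have cont_M: "continuous_on ?I M"
    unfolding M_def dS_def S_def f_def
    by (intro continuous_intros cont_m cont_dm ballI nz)
  have "kerr_sphere H R Sig r\<^sub>0 f p p2 M"
    by (intro kerr_sphere.intro Hf p twice_differentiable_on_dth SigC2 RC2 cont_M R0 S0 fpos p_less M_pos
        M_eq[OF pi_interior(2)]) (assumption | simp add: f_def)+
  then show ?thesis by blast
qed

theorem theorem3p1:
  fixes F G H R Sig :: "real \<Rightarrow> real \<Rightarrow> real" and J :: "real set" and t\<^sub>0 r\<^sub>0 :: real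
  assumes metric: "kerr_like_metric J F G H R Sig"
    and r0: "r\<^sub>0 \<in> J"
    and real_beta: "\<forall>\<theta>\<in>{0<..<pi}. 4 * H r\<^sub>0 \<theta> * (Sig r\<^sub>0 \<theta>)\<^sup>2 - (dth (H r\<^sub>0) \<theta>)\<^sup>2 > 0"
    and mean_curv_pos: "\<forall>\<theta>\<in>{0..pi}. \<forall>\<phi>. mean_curvature F G H R Sig t\<^sub>0 r\<^sub>0 \<phi> \<theta> > 0"
    and K_pos: "\<exists>\<theta>\<^sub>0\<in>{0..pi}. K_fun H R Sig r\<^sub>0 \<theta>\<^sub>0 > 0"
  shows "saddle_critical_at_zero (energy H R Sig r\<^sub>0)"
proof -
  from kerr_like_metric_imp_kerr_sphere[OF metric r0 real_beta mean_curv_pos]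
  obtain f p p2 M where "kerr_sphere H R Sig r\<^sub>0 f p p2 M" by (elim exE)
  then show ?thesis by (rule kerr_sphere.saddle)
qed

end
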